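(* Let $q$ be a nonzero complex number with $|q|<1$. Then \begin{align*} q\,\overline{\phi}_{0}(q)&=-1+q\,g(-q,q^{8})+\frac{\overline{J}_{2,4}\,\overline{J}_{3,8}}{J_2},\\ \overline{\phi}_{1}(q)&=-q^2g(-q^3,q^{8})+\frac{\overline{J}_{2,4}\,\overline{J}_{1,8}}{J_2}. \end{align*}
   Context: Notation: $(x;q)_n:=\prod_{i=0}^{n-1}(1-q^ix)$, $(x;q)_\infty:=\prod_{i\ge0}(1-q^ix)$. Theta functions: $j(x;q):=(x;q)_\infty(q/x;q)_\infty(q;q)_\infty=\sum_{n\in\mathbb{Z}}(-1)^nq^{\binom n2}x^n$; for integers $a,m$ with $m>0$, $J_{a,m}:=j(q^a;q^m)$, $\overline{J}_{a,m}:=j(-q^a;q^m)$, $J_m:=J_{m,3m}=\prod_{i\ge1}(1-q^{mi})$. The universal mock theta function is $$g(x,q):=x^{-1}\Big(-1+\sum_{n=0}^{\infty}\frac{q^{n^2}}{(x;q)_{n+1}(q/x;q)_n}\Big).$$ The functions $\overline{\phi}_0,\overline{\phi}_1$ are $$\overline{\phi}_0(q):=\sum_{n=0}^{\infty}q^n(-q;q)_{2n+1},\qquad \overline{\phi}_1(q):=\sum_{n=0}^{\infty}q^n(-q;q)_{2n}.$$ *)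

theory Defs
  imports "HOL-Analysis.Analysis"
begin

definition qpoch :: "complex \<Rightarrow> complex \<Rightarrow> nat \<Rightarrow> complex" where
  "qpoch x q n = (\<Prod>i<n. 1 - q ^ i * x)"

definition qpoch_inf :: "complex \<Rightarrow> complex \<Rightarrow> complex" where
  "qpoch_inf x q = (\<Prod>i. 1 - q ^ i * x)"

definition theta_j :: "complex \<Rightarrow> complex \<Rightarrow> complex" where
  "theta_j x q = qpoch_inf x q * qpoch_inf (q / x) q * qpoch_inf q q"

text \<open>
  The theta constants usually written with the nome \<open>q\<close> suppressed;
  here it is the last argument. They are meant for \<open>m > 0\<close> and
  \<open>0 < norm q < 1\<close>.
\<close>

definition theta_J :: "int \<Rightarrow> int \<Rightarrow> complex \<Rightarrow> complex" where
  "theta_J a m q = theta_j (q powi a) (q powi m)"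

definition theta_Jbar :: "int \<Rightarrow> int \<Rightarrow> complex \<Rightarrow> complex" where
  "theta_Jbar a m q = theta_j (- (q powi a)) (q powi m)"

definition theta_J1 :: "int \<Rightarrow> complex \<Rightarrow> complex" where
  "theta_J1 m q = theta_J m (3 * m) q"

definition mock_g :: "complex \<Rightarrow> complex \<Rightarrow> complex" where
  "mock_g x q =
     inverse x * (- 1 + (\<Sum>n. q ^ (n ^ 2) / (qpoch x q (n + 1) * qpoch (q / x) q n)))"

definition phi0_bar :: "complex \<Rightarrow> complex" where
  "phi0_bar q = (\<Sum>n. q ^ n * qpoch (- q) q (2 * n + 1))"

definition phi1_bar :: "complex \<Rightarrow> complex" where
  "phi1_bar q = (\<Sum>n. q ^ n * qpoch (- q) q (2 * n))"

end

theory Submission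
  imports Defs "HOL-Library.Nat_Bijection"
begin

text \<open>
  Put \<open>s\<^sup>2 = q\<close>. The Rogers-Fine identity turns
  \<open>\<Sum>n. s ^ n * qpoch (- q) q n = phi1_bar q + s * phi0_bar q\<close> into \<open>mock_g s (s ^ 4)\<close>.
  Expanding each term of \<open>mock_g\<close> in partial fractions and summing the coefficients by Durfee's
  identity writes \<open>mock_g\<close> as a bilateral Lerch sum of level 3, and the parity in \<open>s\<close> separates
  the two functions: each becomes a combination of Lerch sums with base \<open>q ^ 8\<close> and poles at the
  spirals of \<open>q\<close> and \<open>q ^ 5\<close>. On the other side, the partial fraction expansion of a reciprocal
  product \<open>1 / (j(b1) j(b2) j(b3))\<close> of theta functions is a combination of three such Lerch sums.
  With base \<open>q ^ 8\<close> and \<open>b1 = q\<close>, \<open>b2 = q ^ 5\<close>, the choice \<open>b3 = - (q ^ 3)\<close> gives the second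
  formula of the theorem and \<open>b3 = - 1 / q\<close> the first one; the third Lerch sum is
  \<open>mock_g\<close> at \<open>- (q ^ 3)\<close> and at \<open>- q\<close>, respectively.
\<close>

section \<open>Infinite q-Pochhammer symbols\<close>

text \<open>Why three theta functions: partial fractions of one theta function give the exponent
  \<open>tri k\<close>, and Durfee's identity adds k^2 + a k, which makes 3 \<open>tri k\<close> up
  to a linear term; a reciprocal product of n theta functions gives level n. Why these b3: with base
  q^8, b1 = q and b2 = q^5, the weights (the \<open>w\<close> of the Lerch sums) of the first two
  poles are -1/(q^3 b3) and -q^9/b3. The second function needs 1/q^6 and q^6, and both equations say
  b3 = -q^3; the first needs 1/q^2 and q^10, and both say b3 = -1/q. The third weight then is -1 or
  -1/q^8, exactly the weights of the two series for \<open>mock_g\<close>, with exponents n^2 + n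
  and n^2. The pole -1/q is finally reflected to -q. Both uses of partial fractions rest on one
  finite identity, Lagrange interpolation over a window of poles b q^m: one spiral suffices for a
  term of \<open>mock_g\<close>, three spirals and growing windows give the theta product. Limits
  are taken by dominated convergence, so no theory of elliptic functions enters.\<close>

lemma qpoch_0 [simp]: "qpoch x q 0 = 1"
  by (simp add: qpoch_def)

lemma qpoch_Suc: "qpoch x q (Suc n) = qpoch x q n * (1 - q ^ n * x)"
  by (simp add: qpoch_def)

lemma qpoch_Suc_shift: "qpoch x q (Suc n) = (1 - x) * qpoch (q * x) q n"
  unfolding qpoch_def by (subst prod.lessThan_Suc_shift) (simp add: mult_ac)

lemma qpoch_eq_0_iff: "qpoch x q n = 0 \<longleftrightarrow> (\<exists>i<n. q ^ i * x = 1)"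
  by (auto simp: qpoch_def)

lemma qpoch_tendsto:
  assumes "norm q < 1"
  shows "(\<lambda>n. qpoch x q n) \<longlonglongrightarrow> qpoch_inf x q"
proof -
  have "abs_convergent_prod (\<lambda>i. 1 - q ^ i * x)"
    using assms
    by (intro summable_imp_abs_convergent_prod)
       (auto simp: norm_mult norm_power intro!: summable_mult2 summable_geometric)
  then have "convergent_prod (\<lambda>i. 1 - q ^ i * x)"
    by (rule abs_convergent_prod_imp_convergent_prod)
  from convergent_prod_LIMSEQ[OF this] show ?thesis
    unfolding qpoch_def qpoch_inf_def by (simp add: LIMSEQ_lessThan_iff_atMost)
qed

lemma qpoch_inf_nonzero:
  assumes "norm q < 1" "\<And>i. q ^ i * x \<noteq> 1"
  shows "qpoch_inf x q \<noteq> 0"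
proof -
  have "abs_convergent_prod (\<lambda>i. 1 - q ^ i * x)"
    using assms(1)
    by (intro summable_imp_abs_convergent_prod)
       (auto simp: norm_mult norm_power intro!: summable_mult2 summable_geometric)
  then have "convergent_prod (\<lambda>i. 1 - q ^ i * x)"
    by (rule abs_convergent_prod_imp_convergent_prod)
  then show ?thesis
    unfolding qpoch_inf_def by (rule prodinf_nonzero) (use assms(2) in auto)
qed

lemma power_mult_neq_1:
  assumes "norm q < 1" "norm x < 1"
  shows "q ^ i * x \<noteq> (1::complex)"
proof
  assume "q ^ i * x = 1"
  then have "norm q ^ i * norm x = 1"
    by (metis norm_mult norm_power norm_one)
  moreover have "norm q ^ i * norm x \<le> 1 * norm x"
    using assms by (intro mult_right_mono power_le_one) auto
  ultimately show False using assms by simp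
qed

lemma qpoch_nonzero:
  "norm q < 1 \<Longrightarrow> norm x < 1 \<Longrightarrow> qpoch x q n \<noteq> 0"
  using power_mult_neq_1 by (auto simp: qpoch_eq_0_iff)

lemma qpoch_bounded:
  assumes "norm q < 1"
  obtains C where "C > 0" "\<And>n. norm (qpoch x q n) \<le> C"
  using convergent_imp_Bseq[OF convergentI[OF qpoch_tendsto[OF assms]]]
  by (auto simp: Bseq_def)

lemma inverse_qpoch_bounded:
  assumes "norm q < 1" "\<And>i. q ^ i * x \<noteq> 1"
  obtains C where "C > 0" "\<And>n. norm (inverse (qpoch x q n)) \<le> C"
proof -
  have "Bseq (\<lambda>n. inverse (qpoch x q n))"
    by (rule convergent_imp_Bseq, rule convergentI,
        rule tendsto_inverse[OF qpoch_tendsto qpoch_inf_nonzero]) (use assms in auto)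
  then show thesis using that by (auto simp: Bseq_def)
qed

lemma qpoch_inf_shift:
  assumes "norm q < 1"
  shows "qpoch_inf x q = (1 - x) * qpoch_inf (q * x) q"
proof (rule LIMSEQ_unique)
  show "(\<lambda>n. qpoch x q (Suc n)) \<longlonglongrightarrow> qpoch_inf x q"
    using qpoch_tendsto[OF assms] by (rule LIMSEQ_Suc)
  show "(\<lambda>n. qpoch x q (Suc n)) \<longlonglongrightarrow> (1 - x) * qpoch_inf (q * x) q"
    unfolding qpoch_Suc_shift by (intro tendsto_intros qpoch_tendsto assms)
qed

lemma qpoch_inf_mult_minus:
  assumes "norm q < 1"
  shows "qpoch_inf x q * qpoch_inf (- x) q = qpoch_inf (x ^ 2) (q ^ 2)"
proof (rule LIMSEQ_unique)
  have q2: "norm (q ^ 2) < 1"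
    using assms by (simp add: norm_power power_less_one_iff)
  show "(\<lambda>n. qpoch (x ^ 2) (q ^ 2) n) \<longlonglongrightarrow> qpoch_inf (x ^ 2) (q ^ 2)"
    by (rule qpoch_tendsto[OF q2])
  have "qpoch (x ^ 2) (q ^ 2) n = qpoch x q n * qpoch (- x) q n" for n
    unfolding qpoch_def prod.distrib [symmetric]
    by (intro prod.cong) (auto simp: power2_eq_square algebra_simps power_mult_distrib simp flip: power_mult)
  then show "(\<lambda>n. qpoch (x ^ 2) (q ^ 2) n) \<longlonglongrightarrow> qpoch_inf x q * qpoch_inf (- x) q"
    by (auto intro!: tendsto_intros qpoch_tendsto assms)
qed

text \<open>The factors are sorted by the residue of their exponent modulo \<open>m\<close>;
  comparing the partial products of length \<open>n * m\<close> is enough.\<close>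

lemma qpoch_inf_dissect:
  assumes "norm q < 1" "m > 0"
  shows "qpoch_inf x q = (\<Prod>r<m. qpoch_inf (q ^ r * x) (q ^ m))"
proof (rule LIMSEQ_unique)
  have qm: "norm (q ^ m) < 1"
    using assms by (simp add: norm_power power_less_one_iff)
  have "qpoch x q (n * m) = (\<Prod>r<m. qpoch (q ^ r * x) (q ^ m) n)" for n
  proof (induction n)
    case (Suc n)
    have "qpoch x q (Suc n * m) = qpoch x q (n * m) * (\<Prod>i\<in>{n*m..<n*m+m}. 1 - q ^ i * x)"
      unfolding qpoch_def lessThan_atLeast0
      by (subst prod.atLeastLessThan_concat) (auto simp: add.commute)
    also have "(\<Prod>i\<in>{n*m..<n*m+m}. 1 - q ^ i * x) = (\<Prod>r<m. 1 - q ^ (n * m + r) * x)"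
      by (intro prod.reindex_bij_witness[of _ "\<lambda>r. n * m + r" "\<lambda>i. i - n * m"]) auto
    finally show ?case
      using Suc by (simp add: qpoch_Suc prod.distrib power_add power_mult mult_ac)
  qed simp
  then show "(\<lambda>n. qpoch x q (n * m)) \<longlonglongrightarrow> (\<Prod>r<m. qpoch_inf (q ^ r * x) (q ^ m))"
    by (auto intro!: tendsto_intros qpoch_tendsto qm)
  show "(\<lambda>n. qpoch x q (n * m)) \<longlonglongrightarrow> qpoch_inf x q"
    using LIMSEQ_subseq_LIMSEQ[OF qpoch_tendsto[OF assms(1)], of "\<lambda>n. n * m" x] assms(2)
    by (auto simp: strict_mono_def o_def)
qed

section \<open>The universal mock theta function and the Rogers-Fine identity\<close>

text \<open>For nonzero \<open>x\<close> and \<open>0 < norm q < 1\<close> this says that the theta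
  function of \<open>x\<close> does not vanish: its zeros form the spiral of all integer powers of
  \<open>q\<close>. The same condition keeps every denominator of \<open>mock_g\<close> and of the
  Lerch sums away from 0.\<close>

definition off_spiral :: "complex \<Rightarrow> complex \<Rightarrow> bool" where
  "off_spiral x q \<longleftrightarrow> (\<forall>k::int. x * q powi k \<noteq> 1)"

lemma off_spiral_power:
  assumes "off_spiral x q"
  shows "q ^ i * x \<noteq> 1"
  using assms[unfolded off_spiral_def, rule_format, of "int i"] by (simp add: mult.commute)

lemma off_spiral_divide:
  assumes "off_spiral x q" "q \<noteq> 0"
  shows "off_spiral (q / x) q"
  unfolding off_spiral_def
proof
  fix k :: int
  show "q / x * q powi k \<noteq> 1"
  proof
    assume h: "q / x * q powi k = 1"
    then have "x \<noteq> 0" by auto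
    with h have "x = q * q powi k" by (simp add: field_simps)
    also have "\<dots> = q powi (k + 1)" using assms(2) by (simp add: power_int_add)
    finally have "x * q powi (- (k + 1)) = q powi (k + 1) * q powi (- (k + 1))" by simp
    also have "\<dots> = 1" using assms(2) by (subst power_int_add [symmetric]) auto
    finally show False using assms(1) unfolding off_spiral_def by blast
  qed
qed

lemma off_spiral_qpoch_nonzero: "off_spiral x q \<Longrightarrow> qpoch x q n \<noteq> 0"
  using off_spiral_power by (auto simp: qpoch_eq_0_iff)

lemma off_spiral_qpoch_inf_nonzero: "off_spiral x q \<Longrightarrow> norm q < 1 \<Longrightarrow> qpoch_inf x q \<noteq> 0"
  using off_spiral_power by (intro qpoch_inf_nonzero) auto

text \<open>
  For \<open>a = 0\<close> and \<open>a = 1\<close> this is \<open>1 + x * mock_g x q\<close> and \<open>mock_g x q\<close>, respectively.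
\<close>
definition rank_term :: "nat \<Rightarrow> complex \<Rightarrow> complex \<Rightarrow> nat \<Rightarrow> complex" where
  "rank_term a x q n = q ^ (n ^ 2 + a * n) / (qpoch x q (n + 1) * qpoch (q / x) q (n + a))"

definition rank_sum :: "nat \<Rightarrow> complex \<Rightarrow> complex \<Rightarrow> complex" where
  "rank_sum a x q = (\<Sum>n. rank_term a x q n)"

text \<open>The two indices are independent, so that one bound serves for all series and truncations
  below. It exists because both Pochhammer symbols converge to nonzero limits.\<close>

lemma rank_denominator_bounded:
  assumes "norm q < 1" "q \<noteq> 0" "off_spiral x q"
  obtains C where "C > 0" "\<And>m n. norm (inverse (qpoch x q m * qpoch (q / x) q n)) \<le> C"
proof -
  obtain C where C: "C > 0" "\<And>n. norm (inverse (qpoch x q n)) \<le> C"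
    using inverse_qpoch_bounded[OF assms(1) off_spiral_power[OF assms(3)]] by metis
  obtain D where D: "D > 0" "\<And>n. norm (inverse (qpoch (q / x) q n)) \<le> D"
    using inverse_qpoch_bounded[OF assms(1) off_spiral_power[OF off_spiral_divide[OF assms(3,2)]]] by metis
  show thesis
  proof (rule that[of "C * D"])
    fix m n
    show "norm (inverse (qpoch x q m * qpoch (q / x) q n)) \<le> C * D"
      unfolding inverse_mult_distrib norm_mult using C D by (intro mult_mono) (auto intro: less_imp_le)
  qed (use C D in auto)
qed

lemma power_square_le:
  fixes r :: real
  assumes "0 \<le> r" "r < 1"
  shows "r ^ (n ^ 2 + a) \<le> r ^ n"
  using assms by (intro power_decreasing) (auto simp: power2_eq_square intro: trans_le_add1)

lemma rank_term_summable:
  assumes "norm q < 1" "q \<noteq> 0" "off_spiral x q"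
  shows "summable (rank_term a x q)"
proof -
  obtain C where C: "C > 0" "\<And>m n. norm (inverse (qpoch x q m * qpoch (q / x) q n)) \<le> C"
    using rank_denominator_bounded[OF assms] by metis
  show ?thesis
  proof (rule summable_comparison_test')
    show "summable (\<lambda>n. norm q ^ n * C)"
      using assms by (intro summable_mult2 summable_geometric) auto
    fix n :: nat assume "n \<ge> 0"
    show "norm (rank_term a x q n) \<le> norm q ^ n * C"
      unfolding rank_term_def divide_inverse[of "_ ^ _"] norm_mult[of "_ ^ _"] norm_power
      using C assms by (intro mult_mono power_square_le) (auto simp del: norm_inverse)
  qed
qed

text \<open>Connects the series that defines \<open>mock_g\<close> with the one of exponent n^2 + n.
  Rogers-Fine produces the second; the final theorem needs both, since they lead to Lerch sums of
  different weight.\<close>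

lemma rank_sum_0_1:
  assumes "norm q < 1" "q \<noteq> 0" "off_spiral x q" "x \<noteq> 0"
  shows "rank_sum 0 x q = 1 + x * rank_sum 1 x q"
proof -
  define T where "T n = q ^ (n ^ 2) / (qpoch x q n * qpoch (q / x) q n)" for n
  obtain C where C: "C > 0" "\<And>m n. norm (inverse (qpoch x q m * qpoch (q / x) q n)) \<le> C"
    using rank_denominator_bounded[OF assms(1-3)] by metis
  \<comment> \<open>The difference of the two sums telescopes along \<open>T\<close>.\<close>
  have "T \<longlonglongrightarrow> 0"
  proof (rule Lim_null_comparison)
    show "(\<lambda>n. norm q ^ n * C) \<longlonglongrightarrow> 0"
      using assms by (intro tendsto_mult_left_zero LIMSEQ_power_zero) auto
    have "norm (T n) \<le> norm q ^ n * C" for n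
      unfolding T_def divide_inverse[of "_ ^ _"] norm_mult[of "_ ^ _"] norm_power
      using C assms power_square_le[of "norm q" n 0] by (intro mult_mono) (auto simp del: norm_inverse)
    then show "\<forall>\<^sub>F n in sequentially. norm (T n) \<le> norm q ^ n * C" by simp
  qed
  from telescope_sums'[OF this] have "(\<lambda>n. T n - T (Suc n)) sums 1"
    by (simp add: T_def)
  moreover have "T n - T (Suc n) = rank_term 0 x q n - x * rank_term 1 x q n" for n
  proof -
    define A B where "A = qpoch x q n" and "B = qpoch (q / x) q n"
    have os: "off_spiral (q / x) q" using off_spiral_divide assms by blast
    have "q ^ n * x \<noteq> 1" "q ^ n * (q / x) \<noteq> 1"
      by (rule off_spiral_power; fact)+
    then have nz: "A \<noteq> 0" "B \<noteq> 0" "1 - q ^ n * x \<noteq> 0" "1 - q ^ n * (q / x) \<noteq> 0"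
      unfolding A_def B_def using off_spiral_qpoch_nonzero[OF assms(3)] off_spiral_qpoch_nonzero[OF os] by simp_all
    define y where "y = q / x"
    have y: "x * y = q" using assms by (simp add: y_def)
    have "q ^ (n + 1)^2 = q ^ n^2 * (q ^ n * q ^ n * (x * y))"
      unfolding y by (simp add: power2_eq_square algebra_simps power_add)
    moreover have "q ^ (n^2 + n) = q ^ n^2 * q ^ n"
      by (simp add: power_add)
    ultimately show ?thesis
      using nz unfolding T_def rank_term_def Suc_eq_plus1 [symmetric] qpoch_Suc A_def [symmetric] B_def [symmetric]
        y_def [symmetric]
      by (simp add: qpoch_Suc A_def [symmetric] B_def [symmetric] y_def [symmetric] divide_simps power_add)
         (simp add: algebra_simps)
  qed
  ultimately have "(\<lambda>n. rank_term 0 x q n - x * rank_term 1 x q n) sums 1" by simp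
  moreover have "(\<lambda>n. rank_term 0 x q n - x * rank_term 1 x q n) sums (rank_sum 0 x q - x * rank_sum 1 x q)"
    unfolding rank_sum_def by (intro sums_diff sums_mult summable_sums rank_term_summable assms)
  ultimately show ?thesis
    by (simp add: sums_iff algebra_simps)
qed

lemma mock_g_eq_rank_sum_0:
  "mock_g x q = inverse x * (rank_sum 0 x q - 1)"
  by (simp add: mock_g_def rank_sum_def rank_term_def)

lemma mock_g_eq_rank_sum_1:
  assumes "norm q < 1" "q \<noteq> 0" "off_spiral x q" "x \<noteq> 0"
  shows "mock_g x q = rank_sum 1 x q"
  using rank_sum_0_1[OF assms] assms(4) by (simp add: mock_g_eq_rank_sum_0)

lemma qpoch_power_summable:
  assumes "norm q < 1" "norm t < 1"
  shows "summable (\<lambda>n. qpoch x q n * t ^ n)"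
proof -
  obtain C where C: "C > 0" "\<And>n. norm (qpoch x q n) \<le> C"
    using qpoch_bounded[OF assms(1)] by metis
  show ?thesis
  proof (rule summable_comparison_test')
    show "summable (\<lambda>n. C * norm t ^ n)"
      using assms by (intro summable_mult summable_geometric) auto
    fix n :: nat assume "n \<ge> 0"
    show "norm (qpoch x q n * t ^ n) \<le> C * norm t ^ n"
      unfolding norm_mult norm_power using C by (intro mult_right_mono) auto
  qed
qed

text \<open>A case of the Rogers-Fine identity: iterate \<open>(1 - t) f t = 1 + q t f (q t)\<close>.\<close>
lemma rogers_fine:
  assumes "norm q < 1" "norm t < 1"
  shows "(\<lambda>n. t ^ n * q ^ (n * (n + 1) div 2) / qpoch t q (n + 1)) sums (\<Sum>n. qpoch (- q) q n * t ^ n)"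
proof -
  define f where "f s = (\<Sum>n. qpoch (- q) q n * s ^ n)" for s
  have small: "norm (q ^ N * t) \<le> norm t" "norm (q ^ N * t) < 1" for N
  proof -
    show "norm (q ^ N * t) \<le> norm t"
      unfolding norm_mult norm_power using assms by (intro mult_left_le_one_le power_le_one) auto
    then show "norm (q ^ N * t) < 1" using assms by simp
  qed
  \<comment> \<open>The factor 1 + q^(n+1) that \<open>qpoch (- q) q\<close> gains at
    \<open>Suc n\<close> has two summands: the first reproduces \<open>f s\<close>, the second moves
    the argument to \<open>q * s\<close>.\<close>
  have rec: "(1 - s) * f s = 1 + q * s * f (q * s)" if s: "norm s < 1" for s
  proof -
    have qs: "norm (q * s) < 1"
      using norm_mult_less[OF assms(1) s] by simp
    have sum1: "summable (\<lambda>n. qpoch (- q) q n * s ^ n)"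
      and sum2: "summable (\<lambda>n. qpoch (- q) q n * (q * s) ^ n)"
      by (rule qpoch_power_summable; fact)+
    have "f s = 1 + (\<Sum>n. qpoch (- q) q (Suc n) * s ^ Suc n)"
      unfolding f_def using suminf_split_head[OF sum1] by simp
    also have "(\<lambda>n. qpoch (- q) q (Suc n) * s ^ Suc n) =
        (\<lambda>n. s * (qpoch (- q) q n * s ^ n) + s * q * (qpoch (- q) q n * (q * s) ^ n))"
      by (auto simp: qpoch_Suc algebra_simps power_mult_distrib)
    also have "suminf \<dots> = s * f s + s * q * f (q * s)"
      unfolding f_def
      by (subst suminf_add [symmetric]) (use sum1 sum2 in \<open>auto intro!: summable_mult simp: suminf_mult\<close>)
    finally show ?thesis by (simp add: algebra_simps)
  qed
  \<comment> \<open>The factor collected after \<open>N\<close> iterations: the product of q u / (1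
    - u) over u = t, q t, ..., q^(N-1) t.\<close>
  define c where "c N = t ^ N * q ^ (N * (N + 1) div 2) / qpoch t q N" for N
  have nz: "qpoch t q N \<noteq> 0" "1 - q ^ N * t \<noteq> 0" for N
    using qpoch_nonzero[OF assms] power_mult_neq_1[OF assms, of N] by auto
  have partial: "f t = (\<Sum>n<N. t ^ n * q ^ (n * (n + 1) div 2) / qpoch t q (n + 1)) + c N * f (q ^ N * t)" for N
  proof (induction N)
    case (Suc N)
    define u where "u = q ^ N * t"
    have u: "(1 - u) * f u = 1 + q * u * f (q * u)" "1 - u \<noteq> 0"
      using rec[OF small(2)[of N]] nz(2)[of N] by (simp_all add: u_def)
    define b where "b = t ^ N * q ^ (N * (N + 1) div 2)"
    have "Suc N * (Suc N + 1) div 2 = N * (N + 1) div 2 + Suc N"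
      by simp
    then have "t ^ Suc N * q ^ (Suc N * (Suc N + 1) div 2) = b * (q * u)"
      unfolding b_def u_def by (simp only: power_add power_Suc) (simp only: mult_ac)
    then have cs: "c (Suc N) = b * (q * u) / (qpoch t q N * (1 - u))"
      by (simp only: c_def qpoch_Suc u_def)
    have "c N * f u = b * ((1 - u) * f u) / (qpoch t q N * (1 - u))"
      using u(2) by (simp add: c_def b_def)
    also have "\<dots> = b / (qpoch t q N * (1 - u)) + c (Suc N) * f (q * u)"
      unfolding u(1) cs by (simp add: add_divide_distrib algebra_simps)
    also have "b / (qpoch t q N * (1 - u)) = t ^ N * q ^ (N * (N + 1) div 2) / qpoch t q (N + 1)"
      by (simp add: b_def u_def qpoch_Suc)
    finally show ?case
      using Suc by (simp add: u_def mult_ac)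
  qed (simp add: c_def)
  obtain C where C: "C > 0" "\<And>n. norm (inverse (qpoch t q n)) \<le> C"
    using inverse_qpoch_bounded[OF assms(1) power_mult_neq_1[OF assms]] by metis
  obtain D where D: "D > 0" "\<And>n. norm (qpoch (- q) q n) \<le> D"
    using qpoch_bounded[OF assms(1)] by metis
  \<comment> \<open>The arguments q^N t do not leave the disc of radius \<open>norm t\<close>, so
    one geometric majorant bounds all remainders, while \<open>c N\<close> tends to 0.\<close>
  have fb: "norm (f (q ^ N * t)) \<le> (\<Sum>n. D * norm t ^ n)" for N
    unfolding f_def
  proof (rule norm_suminf_le)
    show "summable (\<lambda>n. D * norm t ^ n)" using assms by (intro summable_mult summable_geometric) auto
    show "norm (qpoch (- q) q n * (q ^ N * t) ^ n) \<le> D * norm t ^ n" for n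
      unfolding norm_mult[of "qpoch _ _ _"] norm_power[of "_ * _"]
      using D small(1)[of N] by (intro mult_mono power_mono) (auto intro: less_imp_le)
  qed
  have "(\<lambda>N. c N * f (q ^ N * t)) \<longlonglongrightarrow> 0"
  proof (rule Lim_null_comparison)
    show "(\<lambda>N. (norm t ^ N * C) * (\<Sum>n. D * norm t ^ n)) \<longlonglongrightarrow> 0"
      using assms by (intro tendsto_mult_left_zero LIMSEQ_power_zero) auto
    have "norm (c N) \<le> (norm t ^ N * 1) * C" for N
      unfolding c_def divide_inverse norm_mult norm_power
      using C assms by (intro mult_mono power_le_one) (auto simp del: norm_inverse intro: less_imp_le)
    then show "\<forall>\<^sub>F N in sequentially. norm (c N * f (q ^ N * t)) \<le> (norm t ^ N * C) * (\<Sum>n. D * norm t ^ n)"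
      unfolding norm_mult using fb C by (intro always_eventually allI mult_mono) auto
  qed
  from tendsto_diff[OF tendsto_const[of "f t"] this]
  have "(\<lambda>N. f t - c N * f (q ^ N * t)) \<longlonglongrightarrow> f t" by simp
  moreover have "(\<lambda>N. f t - c N * f (q ^ N * t)) = (\<lambda>N. \<Sum>n<N. t ^ n * q ^ (n * (n + 1) div 2) / qpoch t q (n + 1))"
    using partial by (auto simp: algebra_simps)
  ultimately show ?thesis by (simp add: sums_def f_def)
qed

lemma qpoch_double: "qpoch x (q ^ 2) n * qpoch (q * x) (q ^ 2) n = qpoch x q (2 * n)"
  by (induction n) (simp_all add: qpoch_Suc power_mult [symmetric] mult_ac)

text \<open>Rogers-Fine with t = s and base q = s^2, both sides grouped in pairs. On the left the
  even terms give \<open>phi1_bar\<close> and the odd ones s \<open>phi0_bar\<close>; on the right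
  each pair becomes one fraction, whose denominator splits by parity into two symbols with base
  s^4.\<close>

lemma phi_bar_eq_rank_sum:
  assumes "s \<noteq> 0" "norm s < 1"
  shows "phi1_bar (s ^ 2) + s * phi0_bar (s ^ 2) = rank_sum 1 s (s ^ 4)"
proof -
  define q where "q = s ^ 2"
  have q: "norm q < 1" "q \<noteq> 0" using assms by (auto simp: q_def norm_power power_less_one_iff)
  have sum: "summable (\<lambda>n. qpoch (- q) q n * s ^ n)"
    using qpoch_power_summable[OF q(1) assms(2)] .
  obtain C where C: "C > 0" "\<And>n. norm (qpoch (- q) q n) \<le> C"
    using qpoch_bounded[OF q(1)] by metis
  have sum': "summable (\<lambda>n. q ^ n * qpoch (- q) q (g n))" for g
  proof (rule summable_comparison_test')
    show "summable (\<lambda>n. norm q ^ n * C)" using q by (intro summable_mult2 summable_geometric) auto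
    show "norm (q ^ n * qpoch (- q) q (g n)) \<le> norm q ^ n * C" for n
      unfolding norm_mult norm_power using C by (intro mult_left_mono) auto
  qed
  have lhs: "(\<Sum>n. qpoch (- q) q n * s ^ n) = phi1_bar q + s * phi0_bar q"
  proof -
    have "(\<lambda>n. qpoch (- q) q (2 * n) * s ^ (2 * n) + qpoch (- q) q (2 * n + 1) * s ^ (2 * n + 1)) sums
             (\<Sum>n. qpoch (- q) q n * s ^ n)"
      using sums_group[OF summable_sums[OF sum], of 2]
      by (simp add: eval_nat_numeral mult.commute)
    moreover have "(\<lambda>n. qpoch (- q) q (2 * n) * s ^ (2 * n) + qpoch (- q) q (2 * n + 1) * s ^ (2 * n + 1)) sums
             (phi1_bar q + s * phi0_bar q)"
    proof -
      have "(\<lambda>n. q ^ n * qpoch (- q) q (2 * n) + s * (q ^ n * qpoch (- q) q (2 * n + 1))) sums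
               (phi1_bar q + s * phi0_bar q)"
        unfolding phi1_bar_def phi0_bar_def by (intro sums_add sums_mult summable_sums sum')
      moreover have "q ^ n * qpoch (- q) q (2 * n) + s * (q ^ n * qpoch (- q) q (2 * n + 1)) =
          qpoch (- q) q (2 * n) * s ^ (2 * n) + qpoch (- q) q (2 * n + 1) * s ^ (2 * n + 1)" for n
        unfolding power_add power_mult q_def [symmetric] by simp
      ultimately show ?thesis by (simp only:)
    qed
    ultimately show ?thesis by (rule sums_unique2)
  qed
  have "(\<lambda>n. rank_term 1 s (s ^ 4) n) sums (\<Sum>n. qpoch (- q) q n * s ^ n)"
  proof -
    define g where "g n = s ^ n * q ^ (n * (n + 1) div 2) / qpoch s q (n + 1)" for n
    have "g sums (\<Sum>n. qpoch (- q) q n * s ^ n)"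
      unfolding g_def by (rule rogers_fine[OF q(1) assms(2)])
    from sums_group[OF this, of 2]
    have "(\<lambda>n. g (2 * n) + g (2 * n + 1)) sums (\<Sum>n. qpoch (- q) q n * s ^ n)"
      by (simp add: eval_nat_numeral mult.commute)
    \<comment> \<open>With u = q^(2n+1) s the two terms are in the ratio 1 : u / (1 - u), so they
      add up to the first one divided by 1 - u.\<close>
    moreover have "g (2 * n) + g (2 * n + 1) = rank_term 1 s (s ^ 4) n" for n
    proof -
      have q4: "s ^ 4 = q ^ 2" by (simp add: q_def)
      have q4s: "s ^ 4 / s = q * s" using assms by (simp add: q_def eval_nat_numeral)
      define P where "P = qpoch s q (2 * n + 1)"
      have nz: "P \<noteq> 0" "1 - q ^ (2 * n + 1) * s \<noteq> 0"
        unfolding P_def using qpoch_nonzero[OF q(1) assms(2)] power_mult_neq_1[OF q(1) assms(2), of "2*n+1"] by auto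
      have "qpoch s q (2 * (n + 1)) = P * (1 - q ^ (2 * n + 1) * s)"
        unfolding P_def by (simp add: qpoch_Suc)
      then have "qpoch s (s ^ 4) (n + 1) * qpoch (s ^ 4 / s) (s ^ 4) (n + 1) = P * (1 - q ^ (2 * n + 1) * s)"
        unfolding q4s unfolding q4 qpoch_double .
      moreover have "(s ^ 4) ^ (n ^ 2 + 1 * n) = s ^ (4 * (n^2 + n))"
        by (simp only: power_mult mult_1)
      ultimately have rt: "rank_term 1 s (s ^ 4) n = s ^ (4 * (n^2 + n)) / (P * (1 - q ^ (2 * n + 1) * s))"
        by (simp only: rank_term_def)
      have g1: "g (2 * n) = s ^ (4 * (n^2 + n)) / P"
      proof -
        have "s ^ (2 * n) * q ^ (2 * n * (2 * n + 1) div 2) = s ^ (4 * (n^2 + n))"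
          unfolding q_def power_mult [symmetric] power_add [symmetric]
          by (simp add: power2_eq_square algebra_simps)
        then show ?thesis by (simp add: g_def P_def)
      qed
      have g2: "g (2 * n + 1) = s ^ (4 * (n^2 + n)) * (q ^ (2 * n + 1) * s) / (P * (1 - q ^ (2 * n + 1) * s))"
      proof -
        have "(2 * n + 1) * (2 * n + 1 + 1) div 2 = (2 * n + 1) * (n + 1)" by simp
        then have "s ^ (2 * n + 1) * q ^ ((2 * n + 1) * (2 * n + 1 + 1) div 2) = s ^ (4 * (n^2 + n)) * (q ^ (2 * n + 1) * s)"
          unfolding q_def power_mult [symmetric] power_add [symmetric] power_Suc2 [symmetric]
          by (simp add: power2_eq_square algebra_simps)
        moreover have "qpoch s q (2 * n + 1 + 1) = P * (1 - q ^ (2 * n + 1) * s)"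
          unfolding P_def by (simp add: qpoch_Suc)
        ultimately show ?thesis by (simp only: g_def)
      qed
      show ?thesis unfolding rt g1 g2 using nz by (simp add: divide_simps) (simp add: algebra_simps)
    qed
    ultimately show ?thesis by simp
  qed
  then show ?thesis
    unfolding rank_sum_def q_def [symmetric] lhs [symmetric] by (simp add: sums_iff)
qed

section \<open>Finite partial fractions\<close>

text \<open>The Lagrange interpolation polynomial and the monomial both have degree below
  \<open>card S\<close> and agree at \<open>card S\<close> distinct nodes.\<close>

lemma monomial_lagrange:
  fixes a :: "'i \<Rightarrow> 'a :: field"
  assumes "finite S" "inj_on a S" "M < card S"
  shows "x ^ M = (\<Sum>s\<in>S. a s ^ M * (\<Prod>t\<in>S-{s}. (x - a t) / (a s - a t)))"
proof -
  define P where "P = (\<Sum>s\<in>S. smult (a s ^ M) (\<Prod>t\<in>S-{s}. smult (1 / (a s - a t)) [:- a t, 1:]))"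
  have degP: "degree P < card S"
  proof -
    have "degree (\<Prod>t\<in>S-{s}. smult (1 / (a s - a t)) [:- a t, 1:]) \<le> card S - 1" if "s \<in> S" for s
    proof -
      have "degree (\<Prod>t\<in>S-{s}. smult (1 / (a s - a t)) [:- a t, 1:]) \<le>
               (\<Sum>t\<in>S-{s}. degree (smult (1 / (a s - a t)) [:- a t, 1:]))"
        by (rule order.trans[OF degree_prod_sum_le]) (use assms in \<open>auto simp: o_def\<close>)
      also have "\<dots> \<le> (\<Sum>t\<in>S-{s}. 1)"
        by (rule sum_mono) (auto intro: order.trans[OF degree_smult_le])
      also have "\<dots> = card S - 1" using that assms by simp
      finally show ?thesis .
    qed
    then have "degree P \<le> card S - 1"
      unfolding P_def by (intro degree_sum_le order.trans[OF degree_smult_le]) (use assms in auto)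
    then show ?thesis using assms(3) by linarith
  qed
  have poly_P: "poly P y = (\<Sum>s\<in>S. a s ^ M * (\<Prod>t\<in>S-{s}. (y - a t) / (a s - a t)))" for y
    by (simp add: P_def poly_sum poly_prod add_divide_distrib diff_divide_distrib)
  have "P = monom 1 M"
  proof (rule poly_eqI_degree)
    show "card (a ` S) > degree P" "card (a ` S) > degree (monom (1::'a) M)"
      using degP assms by (simp_all add: card_image degree_monom_eq)
    fix y assume "y \<in> a ` S"
    then obtain s where s: "s \<in> S" "y = a s" by auto
    have "(\<Prod>t\<in>S-{s'}. (y - a t) / (a s' - a t)) = (if s' = s then 1 else 0)" if "s' \<in> S" for s'
    proof (cases "s' = s")
      case True
      have "(\<Prod>t\<in>S-{s'}. (y - a t) / (a s' - a t)) = 1"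
      proof (rule prod.neutral, rule ballI)
        fix t assume "t \<in> S - {s'}"
        then have "a s' \<noteq> a t" using that assms(2) by (auto simp: inj_on_def)
        then show "(y - a t) / (a s' - a t) = 1" using True s by simp
      qed
      then show ?thesis using True by simp
    next
      case False
      then show ?thesis using s assms(1) by (auto intro!: prod_zero)
    qed
    then have "poly P y = (\<Sum>s'\<in>S. if s' = s then a s' ^ M else 0)"
      unfolding poly_P by (intro sum.cong) auto
    then show "poly P y = poly (monom 1 M) y"
      using s assms(1) by (simp add: poly_monom)
  qed
  then show ?thesis
    using poly_P[of x] by (simp add: poly_monom)
qed

text \<open>Interpolate the monomial at the nodes \<open>inverse (c s)\<close> and evaluate at 1.
  The exponent \<open>M\<close> is left free because each choice distributes powers differently
  among the summands, and only a balanced choice survives the passage to infinite windows.\<close>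

lemma partial_fractions:
  fixes c :: "'i \<Rightarrow> 'a :: field"
  assumes "finite S" "inj_on c S" "M < card S" "\<And>s. s \<in> S \<Longrightarrow> c s \<noteq> 0" "\<And>s. s \<in> S \<Longrightarrow> c s \<noteq> 1"
  shows "1 / (\<Prod>s\<in>S. 1 - c s) = (\<Sum>s\<in>S. inverse (c s) ^ M / (\<Prod>t\<in>S-{s}. 1 - c t / c s) / (1 - c s))"
proof -
  define D where "D = (\<Prod>s\<in>S. 1 - c s)"
  have D: "D \<noteq> 0" unfolding D_def using assms by simp
  have "1 = (\<Sum>s\<in>S. inverse (c s) ^ M * (\<Prod>t\<in>S-{s}. (1 - inverse (c t)) / (inverse (c s) - inverse (c t))))"
    using monomial_lagrange[of S "\<lambda>s. inverse (c s)" M 1] assms by (simp add: inj_on_def)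
  also have "\<dots> = (\<Sum>s\<in>S. inverse (c s) ^ M / (\<Prod>t\<in>S-{s}. 1 - c t / c s) / (1 - c s) * D)"
  proof (rule sum.cong[OF refl])
    fix s assume s: "s \<in> S"
    have "D = (1 - c s) * (\<Prod>t\<in>S-{s}. 1 - c t)"
      unfolding D_def using s assms(1) by (simp add: prod.remove)
    moreover have "(\<Prod>t\<in>S-{s}. (1 - inverse (c t)) / (inverse (c s) - inverse (c t))) =
        (\<Prod>t\<in>S-{s}. (1 - c t) / (1 - c t / c s))"
    proof (rule prod.cong[OF refl])
      fix t assume t: "t \<in> S - {s}"
      then have "c t \<noteq> c s" using s assms(2) by (auto simp: inj_on_def)
      then show "(1 - inverse (c t)) / (inverse (c s) - inverse (c t)) = (1 - c t) / (1 - c t / c s)"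
        using assms(4)[OF s] assms(4)[of t] t by (simp add: divide_simps) (auto simp: algebra_simps)
    qed
    ultimately show "inverse (c s) ^ M * (\<Prod>t\<in>S-{s}. (1 - inverse (c t)) / (inverse (c s) - inverse (c t))) =
       inverse (c s) ^ M / (\<Prod>t\<in>S-{s}. 1 - c t / c s) / (1 - c s) * D"
      using assms(5)[OF s] by (simp add: prod_dividef)
  qed
  finally show ?thesis using D unfolding D_def [symmetric] sum_distrib_right [symmetric] by (simp add: field_simps)
qed

section \<open>Products over a finite window of a spiral\<close>

definition tri :: "int \<Rightarrow> int" where "tri k = k * (k + 1) div 2"

lemma double_tri: "2 * tri k = k * (k + 1)"
  unfolding tri_def by (intro dvd_mult_div_cancel) auto

lemma tri_add: "tri (m + k) = tri m + tri k + m * k"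
proof -
  have "2 * tri (m + k) = 2 * (tri m + tri k + m * k)"
    unfolding distrib_left double_tri by (simp add: algebra_simps)
  then show ?thesis by simp
qed

lemma tri_0 [simp]: "tri 0 = 0" and tri_1 [simp]: "tri 1 = 1"
  by (simp_all add: tri_def)

lemma tri_minus: "tri (- k) = tri k - k"
proof -
  have "2 * tri (- k) = 2 * (tri k - k)"
    unfolding right_diff_distrib double_tri by (simp add: algebra_simps)
  then show ?thesis by simp
qed

text \<open>Each factor 1 - z q^(-i) is turned around into -z q^(-i) (1 - q^i / z); the powers of
  \<open>q\<close> pulled out add up to a triangular number.\<close>

lemma prod_below:
  assumes "q \<noteq> 0" "z \<noteq> 0"
  shows "(\<Prod>m\<in>{k - int b..<k}. 1 - z * q powi (m - k)) = qpoch (q / z) q b * ((- z) ^ b * inverse (q powi tri (int b)))"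
proof (induction b)
  case (Suc b)
  have eq: "{k - int (Suc b)..<k} = insert (k - int (Suc b)) {k - int b..<k}" by auto
  have "k - int (Suc b) - k = - int (Suc b)" by simp
  then have "q powi (k - int (Suc b) - k) = inverse (q ^ Suc b)" "q powi (int (Suc b)) = q ^ Suc b"
    by (simp_all only: power_int_minus power_int_of_nat)
  then have "1 - z * q powi (k - int (Suc b) - k) = (1 - q ^ b * (q / z)) * (- z * inverse (q powi int (Suc b)))"
    using assms by (simp add: field_simps)
  moreover have "q powi tri (int (Suc b)) = q powi tri (int b) * q powi (int (Suc b))"
    using tri_add[of "int b" 1] assms by (simp add: power_int_add add.commute)
  ultimately show ?case
    unfolding eq by (subst prod.insert) (auto simp: Suc.IH qpoch_Suc mult_ac)
qed auto

text \<open>The offset \<open>c\<close> is 0 for a full window and 1 when the factor at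
  \<open>k\<close> itself is left out.\<close>

lemma prod_above:
  assumes "q \<noteq> 0"
  shows "(\<Prod>m\<in>{k + int c..<k + int c + int a}. 1 - z * q powi (m - k)) = qpoch (q ^ c * z) q a"
proof (induction a)
  case (Suc a)
  have eq: "{k + int c..<k + int c + int (Suc a)} = insert (k + int c + int a) {k + int c..<k + int c + int a}" by auto
  have "k + int c + int a - k = int (c + a)" by simp
  then have "1 - z * q powi (k + int c + int a - k) = 1 - q ^ a * (q ^ c * z)"
    by (simp only: power_int_of_nat power_add mult_ac)
  then show ?case
    unfolding eq by (subst prod.insert) (auto simp: Suc.IH qpoch_Suc mult_ac)
qed auto

text \<open>The window is cut at \<open>k\<close>: factors from \<open>k\<close> upwards form a
  symbol in \<open>z\<close>, those below are turned around into one in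
  \<open>q / z\<close>.\<close>

lemma prod_spiral:
  assumes "q \<noteq> 0" "z \<noteq> 0" "k \<in> {- int M..<int N}"
  shows "(\<Prod>m\<in>{- int M..<int N}. 1 - z * q powi (m - k)) =
    qpoch z q (nat (int N - k)) * qpoch (q / z) q (nat (int M + k)) *
      ((- z) ^ nat (int M + k) * inverse (q powi tri (int M + k)))"
proof -
  define a b where "a = nat (int N - k)" and "b = nat (int M + k)"
  have ab: "- int M = k - int b" "int N = k + int 0 + int a" "int M + k = int b" using assms(3) by (auto simp: a_def b_def)
  have "{- int M..<int N} = {k - int b..<k} \<union> {k + int 0..<k + int 0 + int a}"
    unfolding ab by auto
  then have "(\<Prod>m\<in>{- int M..<int N}. 1 - z * q powi (m - k)) =
     (\<Prod>m\<in>{k - int b..<k}. 1 - z * q powi (m - k)) * (\<Prod>m\<in>{k + int 0..<k + int 0 + int a}. 1 - z * q powi (m - k))"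
    by (simp only:, subst prod.union_disjoint) auto
  then show ?thesis
    unfolding prod_below[OF assms(1,2)] prod_above[OF assms(1)] a_def [symmetric] b_def [symmetric] ab(3) by simp
qed

text \<open>The case z = 1 of the previous product, without the factor at m = k, which would vanish.
  It covers the poles on the same spiral as the chosen one.\<close>

lemma prod_spiral_1:
  assumes "q \<noteq> 0" "k \<in> {- int M..<int N}"
  shows "(\<Prod>m\<in>{- int M..<int N} - {k}. 1 - q powi (m - k)) =
    qpoch q q (nat (int N - 1 - k)) * qpoch q q (nat (int M + k)) *
      ((- 1) ^ nat (int M + k) * inverse (q powi tri (int M + k)))"
proof -
  define a b where "a = nat (int N - 1 - k)" and "b = nat (int M + k)"
  have ab: "- int M = k - int b" "int N = k + int 1 + int a" "int M + k = int b" using assms(2) by (auto simp: a_def b_def)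
  have "{- int M..<int N} - {k} = {k - int b..<k} \<union> {k + int 1..<k + int 1 + int a}"
    unfolding ab by auto
  then have "(\<Prod>m\<in>{- int M..<int N} - {k}. 1 - 1 * q powi (m - k)) =
     (\<Prod>m\<in>{k - int b..<k}. 1 - 1 * q powi (m - k)) * (\<Prod>m\<in>{k + int 1..<k + int 1 + int a}. 1 - 1 * q powi (m - k))"
    by (simp only:, subst prod.union_disjoint) auto
  then show ?thesis
    unfolding prod_below[OF assms(1) one_neq_zero] prod_above[OF assms(1)] a_def [symmetric] b_def [symmetric] ab(3) by simp
qed

text \<open>
  Why the exponent in the partial fractions is taken to be \<open>card B * M\<close>: with one factor
  \<open>inverse (b * q powi k) ^ M\<close> per theta function, all powers depending on \<open>M\<close> cancel.
\<close>
lemma spiral_weight: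
  assumes "q \<noteq> (0::complex)" "y \<noteq> 0" "b \<noteq> 0" "int M + k \<ge> 0"
  shows "(- y) ^ M * inverse (q powi tri (int M)) * inverse (b * q powi k) ^ M /
           ((- (y / b)) ^ nat (int M + k) * inverse (q powi tri (int M + k))) = (- (b / y)) powi k * q powi tri k"
proof -
  have "(- (y / b)) ^ nat (int M + k) = (- (y / b)) powi (int M + k)"
    using assms(4) by (simp add: power_int_nonneg_exp)
  also have "\<dots> = (- (y / b)) ^ M * (- (y / b)) powi k"
    using assms by (simp add: power_int_add)
  finally have 1: "(- (y / b)) ^ nat (int M + k) = (- (y / b)) ^ M * (- (y / b)) powi k" .
  have 2: "(- (y / b)) ^ M = (- y) ^ M * inverse b ^ M"
    by (simp add: field_simps power_minus[of "y / b"] power_minus[of y])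
  have 3: "inverse ((- (y / b)) powi k) = (- (b / y)) powi k"
    by (simp add: power_int_inverse [symmetric])
  have 4: "q powi tri (int M + k) = q powi tri (int M) * q powi tri k * (q powi k) ^ M"
    using assms(1) unfolding tri_add by (simp add: power_int_add power_int_mult mult.commute[of "int M" k])
  show ?thesis
    unfolding 1 2 4 3 [symmetric] using assms by (simp add: field_simps power_mult_distrib)
qed

text \<open>Distinctness of the poles. Coincidences between two spirals are excluded by
  \<open>off_spiral\<close>, those on one spiral because no nonzero power of \<open>q\<close> has
  norm 1.\<close>

lemma inj_on_spiral:
  assumes "q \<noteq> 0" "norm q < 1" "0 \<notin> B"
    and "\<And>b b'. b \<in> B \<Longrightarrow> b' \<in> B \<Longrightarrow> b \<noteq> b' \<Longrightarrow> off_spiral (b' / b) q"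
  shows "inj_on (\<lambda>(b, m). b * q powi m) (B \<times> R)"
proof (rule inj_onI, clarify)
  fix b b' m m' assume h: "b \<in> B" "b' \<in> B" "b * q powi m = b' * q powi m'"
  have b: "b \<noteq> 0" "b' \<noteq> 0" using h assms(3) by metis+
  have eq: "b' / b * q powi (m' - m) = 1"
    using h(3) b assms(1) by (simp add: power_int_diff)
  with assms(4)[OF h(1,2)] have "b = b'" unfolding off_spiral_def by blast
  moreover have "m = m'"
  proof (rule ccontr)
    assume "m \<noteq> m'"
    have "q powi (m' - m) = 1" using eq b \<open>b = b'\<close> by simp
    then have "norm q powi (m' - m) = 1" by (metis norm_power_int norm_one)
    then show False
      using assms(1,2) \<open>m \<noteq> m'\<close> power_int_strict_decreasing[of 0 "m' - m" "norm q"]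
        power_int_strict_decreasing[of "m' - m" 0 "norm q"]
      by (cases "m' - m > 0") auto
  qed
  ultimately show "b = b' \<and> m = m'" by simp
qed

lemma prod_power_int_distrib:
  fixes f :: "'i \<Rightarrow> 'a :: field"
  shows "(\<Prod>x\<in>A. f x powi k) = (\<Prod>x\<in>A. f x) powi k"
  by (induction A rule: infinite_finite_induct) (auto simp: power_int_mult_distrib)

text \<open>Partial fractions with one pole for each b q^m, where \<open>b\<close> runs through
  \<open>B\<close> and \<open>m\<close> through the window from -M to N - 1. A singleton
  \<open>B\<close> treats the terms of \<open>rank_sum\<close>, three elements and growing windows
  the product of theta functions.\<close>

lemma finite_theta_partial_fractions:
  assumes "q \<noteq> 0" "norm q < 1" "finite B" "B \<noteq> {}" "0 \<notin> B" "N > 0"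
    and osB: "\<And>b. b \<in> B \<Longrightarrow> off_spiral b q"
    and os: "\<And>b b'. b \<in> B \<Longrightarrow> b' \<in> B \<Longrightarrow> b \<noteq> b' \<Longrightarrow> off_spiral (b' / b) q"
  shows "1 / (\<Prod>b\<in>B. qpoch b q N * qpoch (q / b) q M) =
    (\<Sum>b\<in>B. \<Sum>k\<in>{- int M..<int N}. (\<Prod>b'\<in>B. - (b / b')) powi k * q powi (int (card B) * tri k) / (1 - b * q powi k) /
      (qpoch q q (nat (int N - 1 - k)) * qpoch q q (nat (int M + k)) *
        (\<Prod>b'\<in>B-{b}. qpoch (b' / b) q (nat (int N - k)) * qpoch (q / (b' / b)) q (nat (int M + k)))))"
proof -
  define R where "R = {- int M..<int N}"
  define c where "c = (\<lambda>(b, m). b * q powi m :: complex)"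
  \<comment> \<open>What is pulled out when the product over a window is written with
    \<open>qpoch\<close>; it diverges as the window grows and has to cancel.\<close>
  define w where "w = (\<lambda>y. (- y) ^ M * inverse (q powi tri (int M)))"
  have R0: "0 \<in> R" using assms(6) by (simp add: R_def)
  have nzB: "b \<noteq> 0" if "b \<in> B" for b using that assms(5) by metis
  have D: "(\<Prod>p\<in>B\<times>R. 1 - c p) = (\<Prod>b\<in>B. qpoch b q N * qpoch (q / b) q M) * (\<Prod>b\<in>B. w b)"
  proof -
    have "(\<Prod>p\<in>B\<times>R. 1 - c p) = (\<Prod>b\<in>B. \<Prod>m\<in>R. 1 - b * q powi (m - 0))"
      by (simp add: prod.cartesian_product c_def case_prod_unfold)
    also have "\<dots> = (\<Prod>b\<in>B. qpoch b q N * qpoch (q / b) q M * w b)"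
      unfolding R_def by (intro prod.cong refl, subst prod_spiral) (use assms nzB in \<open>auto simp: w_def\<close>)
    finally show ?thesis by (simp only: prod.distrib)
  qed
  have w: "(\<Prod>b\<in>B. w b) \<noteq> 0" using assms(1,3) nzB by (auto simp: w_def)
  have "1 / (\<Prod>b\<in>B. qpoch b q N * qpoch (q / b) q M) = (\<Prod>b\<in>B. w b) * (1 / (\<Prod>p\<in>B\<times>R. 1 - c p))"
    unfolding D using w by simp
  also have "1 / (\<Prod>p\<in>B\<times>R. 1 - c p) =
     (\<Sum>p\<in>B\<times>R. inverse (c p) ^ (card B * M) / (\<Prod>t\<in>B\<times>R-{p}. 1 - c t / c p) / (1 - c p))"
  proof (rule partial_fractions)
    show "inj_on c (B \<times> R)"
      unfolding c_def by (rule inj_on_spiral) (use assms in auto)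
    have "card (B \<times> R) = card B * (M + N)" by (simp add: card_cartesian_product R_def flip: of_nat_add)
    then show "card B * M < card (B \<times> R)" using assms by (simp add: card_gt_0_iff)
    show "finite (B \<times> R)" using assms by (simp add: R_def)
    show "c p \<noteq> 0" if "p \<in> B \<times> R" for p using that assms(1) nzB by (auto simp: c_def)
    show "c p \<noteq> 1" if "p \<in> B \<times> R" for p using that osB by (auto simp: c_def off_spiral_def)
  qed
  also have "(\<Prod>b\<in>B. w b) * \<dots> = (\<Sum>p\<in>B\<times>R. case p of (b, k) \<Rightarrow> (\<Prod>b'\<in>B. - (b / b')) powi k * q powi (int (card B) * tri k) / (1 - b * q powi k) /
      (qpoch q q (nat (int N - 1 - k)) * qpoch q q (nat (int M + k)) *
        (\<Prod>b'\<in>B-{b}. qpoch (b' / b) q (nat (int N - k)) * qpoch (q / (b' / b)) q (nat (int M + k)))))"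
    unfolding sum_distrib_left
  proof (rule sum.cong[OF refl], clarify)
    fix b k assume b: "b \<in> B" and k: "k \<in> R"
    \<comment> \<open>The counterpart of \<open>w\<close> for the window seen from \<open>k\<close>.
      For the spiral of \<open>b\<close> itself its base is -(b/b) = -1, the sign in
      \<open>prod_spiral_1\<close>, so all spirals enter in the same form.\<close>
    define v where "v = (\<lambda>y. (- (y / b)) ^ nat (int M + k) * inverse (q powi tri (int M + k)))"
    define X where "X = qpoch q q (nat (int N - 1 - k)) * qpoch q q (nat (int M + k)) *
        (\<Prod>b'\<in>B-{b}. qpoch (b' / b) q (nat (int N - k)) * qpoch (q / (b' / b)) q (nat (int M + k)))"
    have ratio: "c (b', m) / c (b, k) = b' / b * q powi (m - k)" for b' m
      using assms(1) by (simp add: c_def power_int_diff)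
    \<comment> \<open>The other poles on the spiral of \<open>b\<close> and the poles on the other
      spirals are evaluated by different product formulas.\<close>
    have split: "B \<times> R - {(b, k)} = {b} \<times> (R - {k}) \<union> (B - {b}) \<times> R" using b k by auto
    have "(\<Prod>t\<in>B\<times>R-{(b, k)}. 1 - c t / c (b, k)) =
       (\<Prod>m\<in>R-{k}. 1 - q powi (m - k)) * (\<Prod>b'\<in>B-{b}. \<Prod>m\<in>R. 1 - b' / b * q powi (m - k))"
      unfolding split
      by (subst prod.union_disjoint)
         (use assms(3) nzB[OF b] in \<open>auto simp: R_def prod.cartesian_product' ratio\<close>)
    also have "(\<Prod>m\<in>R-{k}. 1 - q powi (m - k)) = qpoch q q (nat (int N - 1 - k)) * qpoch q q (nat (int M + k)) * v b"
      unfolding R_def v_def using prod_spiral_1[OF assms(1), of k M N] k nzB[OF b] by (simp add: R_def)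
    also have "(\<Prod>b'\<in>B-{b}. \<Prod>m\<in>R. 1 - b' / b * q powi (m - k)) =
       (\<Prod>b'\<in>B-{b}. (qpoch (b' / b) q (nat (int N - k)) * qpoch (q / (b' / b)) q (nat (int M + k))) * v b')"
      unfolding R_def v_def
      by (intro prod.cong refl prod_spiral) (use assms(1) k nzB b in \<open>auto simp: R_def\<close>)
    finally have den: "(\<Prod>t\<in>B\<times>R-{(b, k)}. 1 - c t / c (b, k)) = X * (\<Prod>b'\<in>B. v b')"
      using b assms(3) by (simp add: X_def prod.distrib prod.remove[of B b v])
    have "(\<Prod>b'\<in>B. w b') * inverse (c (b, k)) ^ (card B * M) / (\<Prod>b'\<in>B. v b') =
       (\<Prod>b'\<in>B. w b' * inverse (b * q powi k) ^ M / v b')"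
      by (simp add: c_def power_mult mult.commute[of "card B"] prod_dividef prod.distrib prod_constant)
    also have "\<dots> = (\<Prod>b'\<in>B. (- (b / b')) powi k * q powi tri k)"
      unfolding w_def v_def
      by (intro prod.cong refl spiral_weight) (use assms(1) nzB b k in \<open>auto simp: R_def\<close>)
    also have "\<dots> = (\<Prod>b'\<in>B. - (b / b')) powi k * q powi (int (card B) * tri k)"
      by (simp add: prod.distrib prod_constant power_int_mult mult.commute[of "int (card B)"] prod_power_int_distrib)
    finally have weight: "(\<Prod>b'\<in>B. w b') * inverse (c (b, k)) ^ (card B * M) / (\<Prod>b'\<in>B. v b') = \<dots>" .
    have "(\<Prod>b\<in>B. w b) * (inverse (c (b, k)) ^ (card B * M) / (\<Prod>t\<in>B\<times>R-{(b, k)}. 1 - c t / c (b, k)) / (1 - c (b, k))) =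
       ((\<Prod>b'\<in>B. w b') * inverse (c (b, k)) ^ (card B * M) / (\<Prod>b'\<in>B. v b')) / (1 - c (b, k)) / X"
      unfolding den by (simp add: field_simps)
    also have "\<dots> = (\<Prod>b'\<in>B. - (b / b')) powi k * q powi (int (card B) * tri k) / (1 - b * q powi k) / X"
      unfolding weight by (simp add: c_def)
    finally show "(\<Prod>b\<in>B. w b) * (inverse (c (b, k)) ^ (card B * M) / (\<Prod>t\<in>B\<times>R-{(b, k)}. 1 - c t / c (b, k)) / (1 - c (b, k))) =
        (\<Prod>b'\<in>B. - (b / b')) powi k * q powi (int (card B) * tri k) / (1 - b * q powi k) /
      (qpoch q q (nat (int N - 1 - k)) * qpoch q q (nat (int M + k)) *
        (\<Prod>b'\<in>B-{b}. qpoch (b' / b) q (nat (int N - k)) * qpoch (q / (b' / b)) q (nat (int M + k))))"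
      unfolding X_def .
  qed
  finally show ?thesis
    by (simp only: sum.cartesian_product R_def)
qed

section \<open>Durfee's identity\<close>

text \<open>Combinatorially, partitions are sorted by their largest rectangle of shape r times r +
  a, a Durfee square for a = 0. The proof is analytic: once the sum is known not to depend on
  \<open>a\<close>, its value is read off as \<open>a\<close> tends to infinity.\<close>

lemma durfee_identity:
  assumes "norm q < 1"
  shows "(\<lambda>r. q ^ (r ^ 2 + a * r) / (qpoch q q r * qpoch q q (r + a))) sums (1 / qpoch_inf q q)"
proof -
  define d where "d = (\<lambda>a r. q ^ (r ^ 2 + a * r) / (qpoch q q r * qpoch q q (r + a)))"
  define D where "D = (\<lambda>a. \<Sum>r. d a r)"
  define E where "E = (\<lambda>a. D a - D (Suc a))"
  obtain C where C: "C > 0" "\<And>n. norm (inverse (qpoch q q n)) \<le> C"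
    using inverse_qpoch_bounded[OF assms power_mult_neq_1[OF assms assms]] by metis
  have nz: "qpoch q q n \<noteq> 0" for n
    using qpoch_nonzero[OF assms assms] .
  have dbound: "norm (q ^ k / (qpoch q q m * qpoch q q n)) \<le> norm q ^ r * (C * C)" if "k \<ge> r" for k r m n
    unfolding divide_inverse inverse_mult_distrib norm_mult norm_power
    using C assms that by (intro mult_mono power_decreasing) (auto simp del: norm_inverse intro: less_imp_le)
  have geo: "summable (\<lambda>r. norm q ^ r * (C * C))"
    using assms by (intro summable_mult2 summable_geometric) auto
  have dbound': "norm (d a r) \<le> norm q ^ r * (C * C)" for a r
    unfolding d_def by (rule dbound) (simp add: power2_eq_square trans_le_add1)
  have dsum: "summable (d a)" for a
    by (rule summable_comparison_test'[OF geo]) (rule dbound')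
  \<comment> \<open>The sum does not depend on \<open>a\<close>: its differences \<open>E a\<close> are bounded and satisfy a contracting recursion.\<close>
  have rec: "E a = - (q ^ Suc a * E (Suc a))" for a
  proof -
    \<comment> \<open>Over a common denominator the difference has numerator 1 - q^r - q^(r+a+1).
      The part 1 - q^r goes into \<open>A\<close>: it vanishes at r = 0 and cancels the last factor
      of \<open>qpoch q q r\<close> otherwise, so \<open>A\<close> can be shifted by one and
      combined with \<open>B\<close>.\<close>
    define A where "A = (\<lambda>r. q ^ (r ^ 2 + a * r) * (1 - q ^ r) / (qpoch q q r * qpoch q q (r + Suc a)))"
    define B where "B = (\<lambda>r. q ^ (r ^ 2 + a * r + (r + Suc a)) / (qpoch q q r * qpoch q q (r + Suc a)))"
    have d_A: "d a r - d (Suc a) r = A r - B r" for r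
    proof -
      have "q ^ r * (q * q ^ a) \<noteq> 1"
        using power_mult_neq_1[OF assms assms, of "r + a"] by (simp add: power_add mult_ac)
      moreover have "qpoch q q (r + Suc a) = qpoch q q (r + a) * (1 - q ^ r * (q * q ^ a))"
        by (simp add: qpoch_Suc power_add mult_ac)
      ultimately show ?thesis
        using nz[of r] nz[of "r + a"]
        by (simp add: d_def A_def B_def power_add divide_simps) (simp add: algebra_simps)
    qed
    have A_B: "A (Suc r) - B r = - (q ^ Suc a * (d (Suc a) r - d (Suc (Suc a)) r))" for r
    proof -
      have nz': "1 - q ^ r * (q * q) * q ^ a \<noteq> 0" "1 - q ^ r * q \<noteq> 0"
        using power_mult_neq_1[OF assms assms, of "r + a + 1"] power_mult_neq_1[OF assms assms, of "r"]
        by (simp_all add: power_add mult_ac)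
      define X Y where "X = qpoch q q r" and "Y = qpoch q q (r + Suc a)"
      have q1: "qpoch q q (Suc r) = X * (1 - q ^ r * q)" by (simp add: qpoch_Suc X_def)
      have q2: "qpoch q q (r + Suc (Suc a)) = Y * (1 - q ^ r * (q * q) * q ^ a)"
        "qpoch q q (Suc r + Suc a) = Y * (1 - q ^ r * (q * q) * q ^ a)"
        by (simp_all add: qpoch_Suc Y_def power_add mult_ac)
      define Z where "Z = q ^ (r ^ 2 + a * r)"
      have e1: "q ^ ((Suc r)\<^sup>2 + a * Suc r) = Z * (q ^ r * q ^ r * q * q ^ a)"
        unfolding Z_def by (simp add: power2_eq_square power_add mult_ac)
      have e2: "q ^ (r ^ 2 + a * r + (r + Suc a)) = Z * (q ^ r * q * q ^ a)"
        unfolding Z_def by (simp add: power_add mult_ac)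
      have e3: "q ^ (r ^ 2 + Suc a * r) = Z * q ^ r" "q ^ (r ^ 2 + Suc (Suc a) * r) = Z * q ^ r * q ^ r"
        unfolding Z_def by (simp_all add: power_add mult_ac)
      show ?thesis
        using nz[of r] nz[of "r + Suc a"] nz'
        unfolding A_def B_def d_def q1 q2 e1 e2 e3 X_def [symmetric] Y_def [symmetric]
        by (simp add: divide_simps) (simp add: algebra_simps)
    qed
    have sumB: "summable B"
      by (rule summable_comparison_test'[OF geo], unfold B_def, rule dbound) simp
    have sumd: "summable (\<lambda>r. d a r - d (Suc a) r)"
      by (intro summable_diff dsum)
    have sumA: "summable A"
      using summable_add[OF sumd sumB] by (simp add: d_A)
    have "E a = (\<Sum>r. A r - B r)"
      unfolding E_def D_def using suminf_diff[OF dsum dsum, of a "Suc a"] by (simp add: d_A)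
    also have "\<dots> = (\<Sum>r. A r) - (\<Sum>r. B r)"
      by (rule suminf_diff [OF sumA sumB, symmetric])
    also have "(\<Sum>r. A r) = (\<Sum>r. A (Suc r))"
      using suminf_split_head[OF sumA] by (simp add: A_def)
    also have "(\<Sum>r. A (Suc r)) - (\<Sum>r. B r) = (\<Sum>r. A (Suc r) - B r)"
      by (intro suminf_diff sumB) (use sumA in \<open>simp add: summable_Suc_iff\<close>)
    also have "\<dots> = (\<Sum>r. - (q ^ Suc a) * (d (Suc a) r - d (Suc (Suc a)) r))"
      by (simp only: A_B minus_mult_left)
    also have "\<dots> = - (q ^ Suc a) * (\<Sum>r. d (Suc a) r - d (Suc (Suc a)) r)"
      by (intro suminf_mult summable_diff dsum)
    also have "(\<Sum>r. d (Suc a) r - d (Suc (Suc a)) r) = E (Suc a)"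
      unfolding E_def D_def by (intro suminf_diff [symmetric] dsum)
    finally show ?thesis by simp
  qed
  have Dbound: "norm (D a) \<le> (\<Sum>r. norm q ^ r * (C * C))" for a
    unfolding D_def by (rule norm_suminf_le[OF dbound' geo])
  define K where "K = 2 * (\<Sum>r. norm q ^ r * (C * C))"
  have Ebound: "norm (E a) \<le> norm q ^ n * K" for a n
  proof (induction n arbitrary: a)
    case 0
    show ?case
      unfolding E_def K_def using norm_triangle_ineq4[of "D a" "D (Suc a)"] Dbound[of a] Dbound[of "Suc a"] by simp
  next
    case (Suc n)
    have "norm (E a) = norm q ^ Suc a * norm (E (Suc a))"
      by (subst rec) (simp add: norm_mult norm_power)
    also have "\<dots> \<le> norm q ^ 1 * (norm q ^ n * K)"
      using assms Suc.IH by (intro mult_mono power_decreasing) auto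
    finally show ?case by simp
  qed
  have "E a = 0" for a
  proof -
    have "(\<lambda>n. norm q ^ n * K) \<longlonglongrightarrow> 0"
      using assms by (intro tendsto_mult_left_zero LIMSEQ_power_zero) auto
    then have "norm (E a) \<le> 0"
      by (rule LIMSEQ_le_const) (use Ebound in auto)
    then show ?thesis by simp
  qed
  then have const: "D a = D 0" for a
    by (induction a) (auto simp: E_def)
  \<comment> \<open>Every term with r > 0 carries the factor q^(a r) and dies out; only r = 0
    contributes to the limit.\<close>
  have "(\<lambda>a. D a) \<longlonglongrightarrow> (\<Sum>r. if r = 0 then 1 / qpoch_inf q q else 0)"
    unfolding D_def
  proof (rule tannerys_theorem [THEN conjunct2, THEN conjunct2])
    show "\<forall>\<^sub>F (r, a) in sequentially \<times>\<^sub>F sequentially. norm (d a r) \<le> norm q ^ r * (C * C)"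
      using dbound' by (intro always_eventually) auto
    fix r
    have lim: "(\<lambda>a. inverse (qpoch q q (r + a))) \<longlonglongrightarrow> inverse (qpoch_inf q q)"
      using LIMSEQ_ignore_initial_segment[OF tendsto_inverse[OF qpoch_tendsto qpoch_inf_nonzero], of q q r]
        assms power_mult_neq_1[OF assms assms] by (simp add: add.commute)
    show "(\<lambda>a. d a r) \<longlonglongrightarrow> (if r = 0 then 1 / qpoch_inf q q else 0)"
    proof (cases "r = 0")
      case True
      then show ?thesis using lim by (simp add: d_def divide_inverse)
    next
      case False
      have "norm (q ^ r) < 1" using assms False by (auto simp: norm_power power_less_one_iff)
      then have "(\<lambda>a. q ^ (r ^ 2) * (q ^ r) ^ a * (inverse (qpoch q q r) * inverse (qpoch q q (r + a)))) \<longlonglongrightarrow>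
          q ^ (r ^ 2) * 0 * (inverse (qpoch q q r) * inverse (qpoch_inf q q))"
        by (rule tendsto_mult[OF tendsto_mult[OF tendsto_const LIMSEQ_power_zero] tendsto_mult[OF tendsto_const lim]])
      then show ?thesis using False
        by (simp add: d_def power_add power_mult [symmetric] divide_inverse mult.commute[of r])
    qed
  qed (use geo in auto)
  moreover have "(\<lambda>a. D a) \<longlonglongrightarrow> D 0"
    by (rule tendsto_eventually, rule always_eventually, rule allI, rule const)
  ultimately have "D 0 = (\<Sum>r. if r = 0 then 1 / qpoch_inf q q else 0)"
    using LIMSEQ_unique by blast
  also have "\<dots> = 1 / qpoch_inf q q"
    by (subst suminf_finite[of "{0}"]) auto
  finally show ?thesis
    using summable_sums[OF dsum, of a] const[of a] by (simp add: D_def d_def)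
qed

section \<open>Lerch sums\<close>

lemma summable_on_int_halves:
  fixes f :: "int \<Rightarrow> 'a :: banach"
  assumes "(\<lambda>n::nat. f (int n)) summable_on UNIV" "(\<lambda>n::nat. f (- 1 - int n)) summable_on UNIV"
  shows "f summable_on UNIV"
proof -
  have "f summable_on {0..}"
    using assms(1) by (subst (asm) summable_on_reindex_bij_witness[of _ nat int "{0..}" f]) auto
  moreover have "f summable_on {..<0}"
    using assms(2)
    by (subst (asm) summable_on_reindex_bij_witness[of _ "\<lambda>k. nat (- 1 - k)" "\<lambda>n. - 1 - int n" "{..<0}" f]) auto
  ultimately have "f summable_on ({0..} \<union> {..<0})"
    by (intro summable_on_Un_disjoint) auto
  also have "{0..} \<union> {..<0::int} = UNIV" by auto
  finally show ?thesis .
qed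

text \<open>Consecutive terms have the ratio B r^(s (n+1)), which tends to 0 however large
  \<open>B\<close> is.\<close>

lemma summable_power_tri:
  fixes r B :: real
  assumes "0 < r" "r < 1" "B \<ge> 0" "s > 0"
  shows "summable (\<lambda>n. B ^ n * r powi (int s * tri (int n)))"
proof -
  have "(\<lambda>n. B * (r ^ s) ^ Suc n) \<longlonglongrightarrow> B * 0"
    using assms
    by (intro tendsto_mult tendsto_const LIMSEQ_Suc LIMSEQ_power_zero) (auto simp: power_less_one_iff)
  then have "\<forall>\<^sub>F n in sequentially. B * (r ^ s) ^ Suc n < 1 / 2"
    by (rule order_tendstoD) simp
  then obtain N where N: "\<And>n. n \<ge> N \<Longrightarrow> B * (r ^ s) ^ Suc n < 1 / 2"
    unfolding eventually_sequentially by blast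
  show ?thesis
  proof (rule summable_ratio_test)
    fix n assume "N \<le> n"
    have "int s * tri (int (Suc n)) = int s * tri (int n) + int (s * Suc n)"
      using tri_add[of "int n" 1] by (simp add: algebra_simps)
    then have "r powi (int s * tri (int (Suc n))) = r powi (int s * tri (int n)) * r powi int (s * Suc n)"
      using assms by (simp only: power_int_add[OF disjI1[OF less_imp_neq[OF assms(1), symmetric]]])
    then have "r powi (int s * tri (int (Suc n))) = r powi (int s * tri (int n)) * (r ^ s) ^ Suc n"
      by (simp only: power_int_of_nat power_mult)
    then have "B ^ Suc n * r powi (int s * tri (int (Suc n))) =
       (B * (r ^ s) ^ Suc n) * (B ^ n * r powi (int s * tri (int n)))"
      by (simp only: power_Suc mult_ac)
    also have "\<dots> \<le> 1 / 2 * (B ^ n * r powi (int s * tri (int n)))"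
      using N[OF \<open>N \<le> n\<close>] assms by (intro mult_right_mono) auto
    finally show "norm (B ^ Suc n * r powi (int s * tri (int (Suc n)))) \<le>
           1 / 2 * norm (B ^ n * r powi (int s * tri (int n)))"
      using assms by simp
  qed simp
qed

lemma summable_on_powi_tri:
  assumes "q \<noteq> (0::complex)" "norm q < 1" "w \<noteq> (0::complex)" "s > 0"
  shows "(\<lambda>k::int. norm (w powi k * q powi (int s * tri k))) summable_on UNIV"
proof (rule summable_on_int_halves)
  show "(\<lambda>n. norm (w powi int n * q powi (int s * tri (int n)))) summable_on UNIV"
    using summable_power_tri[of "norm q" "norm w" s] assms
    by (subst summable_on_UNIV_nonneg_real_iff) (auto simp: norm_mult norm_power_int norm_power)
  \<comment> \<open>The reflection of \<open>k\<close> to -1 - k preserves \<open>tri\<close>, so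
    the negative half is a series of the same kind with \<open>w\<close> inverted.\<close>
  have "tri (- 1 - int n) = tri (int n)" for n
    using tri_minus[of "1 + int n"] tri_add[of 1 "int n"] by simp
  moreover have "w powi (- 1 - int n) = inverse w * inverse w ^ n" for n
  proof -
    have "w powi (- 1 - int n) = w powi (- int (Suc n))" by simp
    then show ?thesis by (simp only: power_int_minus power_int_of_nat power_inverse power_Suc inverse_mult_distrib)
  qed
  ultimately have "norm (w powi (- 1 - int n) * q powi (int s * tri (- 1 - int n))) =
     inverse (norm w) * (inverse (norm w) ^ n * norm q powi (int s * tri (int n)))" for n
    by (simp only: norm_mult norm_power_int norm_power norm_inverse mult.assoc)
  then show "(\<lambda>n. norm (w powi (- 1 - int n) * q powi (int s * tri (- 1 - int n)))) summable_on UNIV"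
    using summable_power_tri[of "norm q" "inverse (norm w)" s] assms
    by (subst summable_on_UNIV_nonneg_real_iff) (auto intro!: summable_mult simp del: power_inverse)
qed

text \<open>For k to infinity the inverse tends to 1; for k to minus infinity it equals q^n / (q^n -
  x) with n = -k and tends to 0. In between, no denominator vanishes.\<close>

lemma off_spiral_inverse_bounded:
  assumes "q \<noteq> 0" "norm q < 1" "off_spiral x q" "x \<noteq> 0"
  obtains C where "C > 0" "\<And>k. norm (inverse (1 - x * q powi k)) \<le> C"
proof -
  have lim: "(\<lambda>n. q ^ n) \<longlonglongrightarrow> 0" using assms(2) by (rule LIMSEQ_power_zero)
  have "(\<lambda>n. inverse (1 - x * q ^ n)) \<longlonglongrightarrow> inverse (1 - x * 0)"
    by (intro tendsto_intros lim) simp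
  then have "Bseq (\<lambda>n. inverse (1 - x * q ^ n))"
    using convergent_imp_Bseq convergentI by blast
  then obtain C where C: "C > 0" "\<And>n. norm (inverse (1 - x * q ^ n)) \<le> C"
    by (auto simp: Bseq_def)
  have "(\<lambda>n. q ^ Suc n * inverse (q ^ Suc n - x)) \<longlonglongrightarrow> 0 * inverse (0 - x)"
    using assms(4) by (intro tendsto_intros LIMSEQ_Suc lim) auto
  then have "Bseq (\<lambda>n. q ^ Suc n * inverse (q ^ Suc n - x))"
    using convergent_imp_Bseq convergentI by blast
  then obtain D where D: "D > 0" "\<And>n. norm (q ^ Suc n * inverse (q ^ Suc n - x)) \<le> D"
    by (auto simp: Bseq_def)
  show thesis
  proof (rule that[of "max C D"])
    fix k :: int
    show "norm (inverse (1 - x * q powi k)) \<le> max C D"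
    proof (cases "k \<ge> 0")
      case True
      then show ?thesis using C(2)[of "nat k"] by (simp add: power_int_nonneg_exp)
    next
      case False
      then obtain n where "k = - int (Suc n)"
        by (metis negD not_le)
      then have p: "q powi k = inverse (q ^ Suc n)"
        by (simp only: power_int_minus power_int_of_nat)
      have "inverse (1 - x * q powi k) = q ^ Suc n * inverse (q ^ Suc n - x)"
        unfolding p using assms(1) by (simp add: divide_simps)
      then show ?thesis using D(2)[of n] by simp
    qed
  qed (use C in auto)
qed

text \<open>The sign \<open>(- 1) ^ k\<close> of the classical Lerch sums is absorbed into \<open>w\<close>.\<close>
definition lerch_term :: "nat \<Rightarrow> complex \<Rightarrow> complex \<Rightarrow> complex \<Rightarrow> int \<Rightarrow> complex" where
  "lerch_term s w x q k = w powi k * q powi (int s * tri k) / (1 - x * q powi k)"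

definition lerch_sum :: "nat \<Rightarrow> complex \<Rightarrow> complex \<Rightarrow> complex \<Rightarrow> complex" where
  "lerch_sum s w x q = (\<Sum>\<^sub>\<infinity>k. lerch_term s w x q k)"

lemma lerch_term_abs_summable:
  assumes "q \<noteq> 0" "norm q < 1" "w \<noteq> 0" "x \<noteq> 0" "off_spiral x q" "s > 0"
  shows "(\<lambda>k. norm (lerch_term s w x q k)) summable_on UNIV"
proof -
  obtain C where C: "C > 0" "\<And>k. norm (inverse (1 - x * q powi k)) \<le> C"
    using off_spiral_inverse_bounded[OF assms(1,2,5,4)] by metis
  show ?thesis
  proof (rule Infinite_Sum.abs_summable_on_comparison_test')
    show "(\<lambda>k. norm (w powi k * q powi (int s * tri k)) * C) summable_on UNIV"
      by (intro summable_on_cmult_left summable_on_powi_tri assms)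
    show "norm (lerch_term s w x q k) \<le> norm (w powi k * q powi (int s * tri k)) * C" for k
      unfolding lerch_term_def divide_inverse norm_mult[of "_ * _"] using C by (intro mult_left_mono) auto
  qed
qed

lemma lerch_term_summable:
  assumes "q \<noteq> 0" "norm q < 1" "w \<noteq> 0" "x \<noteq> 0" "off_spiral x q" "s > 0"
  shows "lerch_term s w x q summable_on UNIV"
  using abs_summable_summable[OF lerch_term_abs_summable[OF assms]] .

text \<open>Enumerates the integers by naturals, so that \<open>tannerys_theorem\<close>, which is
  about series, applies to sums over the integers.\<close>

lemma infsum_int_decode:
  fixes f :: "int \<Rightarrow> 'a :: banach"
  assumes "(\<lambda>k. norm (f k)) summable_on UNIV"
  shows "infsum f UNIV = (\<Sum>n. f (int_decode n))"
proof -
  have "(f has_sum infsum f UNIV) UNIV"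
    by (rule has_sum_infsum[OF abs_summable_summable[OF assms]])
  then have "((\<lambda>n. f (int_decode n)) has_sum infsum f UNIV) UNIV"
    using has_sum_reindex_bij_betw[OF bij_int_decode] by blast
  then show ?thesis using has_sum_imp_sums sums_unique by blast
qed

lemma infsum_int_tannery:
  fixes f :: "nat \<Rightarrow> int \<Rightarrow> 'a :: {real_normed_algebra, banach}"
  assumes lim: "\<And>k. (\<lambda>n. f n k) \<longlonglongrightarrow> g k"
    and bound: "\<And>n k. norm (f n k) \<le> M k" and M: "M summable_on UNIV"
  shows "(\<lambda>n. infsum (f n) UNIV) \<longlonglongrightarrow> infsum g UNIV"
proof -
  have gb: "norm (g k) \<le> M k" for k
    by (rule LIMSEQ_le_const2[OF tendsto_norm[OF lim[of k]]]) (use bound in auto)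
  have "(\<lambda>n. \<Sum>i. f n (int_decode i)) \<longlonglongrightarrow> (\<Sum>i. g (int_decode i))"
  proof (rule tannerys_theorem [THEN conjunct2, THEN conjunct2])
    show "\<forall>\<^sub>F (i, n) in sequentially \<times>\<^sub>F sequentially. norm (f n (int_decode i)) \<le> M (int_decode i)"
      using bound by (intro always_eventually) auto
    show "summable (\<lambda>i. M (int_decode i))"
      using M summable_on_reindex_bij_betw[OF bij_int_decode, of M] summable_on_imp_summable by blast
  qed (use lim in auto)
  moreover have "infsum (f n) UNIV = (\<Sum>i. f n (int_decode i))" for n
    by (intro infsum_int_decode Infinite_Sum.abs_summable_on_comparison_test'[OF M] bound)
  moreover have "infsum g UNIV = (\<Sum>i. g (int_decode i))"
    by (intro infsum_int_decode Infinite_Sum.abs_summable_on_comparison_test'[OF M] gb)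
  ultimately show ?thesis by simp
qed

lemma filterlim_nat_shift: "filterlim (\<lambda>n. nat (int n + c)) at_top sequentially"
proof -
  have "Z \<le> nat (int n + c)" if "n \<ge> Z + nat (- c)" for n Z
  proof -
    have "int Z + (- c) \<le> int n" using that by (auto simp: nat_le_iff)
    then show ?thesis by (simp add: le_nat_iff)
  qed
  then show ?thesis
    unfolding filterlim_at_top eventually_sequentially by blast
qed

lemma qpoch_shift_tendsto:
  assumes "norm q < 1"
  shows "(\<lambda>n. qpoch z q (nat (int n + c))) \<longlonglongrightarrow> qpoch_inf z q"
  using filterlim_compose[OF qpoch_tendsto[OF assms] filterlim_nat_shift] .

text \<open>The finite identity with both ends of the window going to infinity, by dominated
  convergence. The squared \<open>qpoch_inf q q\<close> is the limit of the two symbols that come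
  from the spiral of the pole itself.\<close>

theorem theta_partial_fractions:
  assumes "q \<noteq> 0" "norm q < 1" "finite B" "B \<noteq> {}" "0 \<notin> B"
    and osB: "\<And>b. b \<in> B \<Longrightarrow> off_spiral b q"
    and os: "\<And>b b'. b \<in> B \<Longrightarrow> b' \<in> B \<Longrightarrow> b \<noteq> b' \<Longrightarrow> off_spiral (b' / b) q"
  shows "qpoch_inf q q ^ 2 / (\<Prod>b\<in>B. qpoch_inf b q * qpoch_inf (q / b) q) =
    (\<Sum>b\<in>B. lerch_sum (card B) (\<Prod>b'\<in>B. - (b / b')) b q /
       (\<Prod>b'\<in>B-{b}. qpoch_inf (b' / b) q * qpoch_inf (q / (b' / b)) q))"
proof -
  define R where "R = (\<lambda>n. {- int (Suc n)..<int (Suc n)})"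
  define X where "X = (\<lambda>b i j i' j'. qpoch q q i * qpoch q q j *
    (\<Prod>b'\<in>B-{b}. qpoch (b' / b) q i' * qpoch (q / (b' / b)) q j'))"
  define T where "T = (\<lambda>b. lerch_term (card B) (\<Prod>b'\<in>B. - (b / b')) b q)"
  \<comment> \<open>Extension by 0 outside the window puts all truncations on one index set. The
    lengths are written as \<open>nat (int n + c)\<close>, the shape that
    \<open>qpoch_shift_tendsto\<close> expects, with N = M = n + 1.\<close>
  define f where "f = (\<lambda>b n k. if k \<in> R n then
     T b k / X b (nat (int n + - k)) (nat (int n + (1 + k))) (nat (int n + (1 - k))) (nat (int n + (1 + k))) else 0)"
  define Y where "Y = (\<lambda>b. qpoch_inf q q * qpoch_inf q q * (\<Prod>b'\<in>B-{b}. qpoch_inf (b' / b) q * qpoch_inf (q / (b' / b)) q))"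
  have nzB: "b \<noteq> 0" if "b \<in> B" for b using that assms(5) by metis
  have qinf: "qpoch_inf q q \<noteq> 0"
    using assms by (intro qpoch_inf_nonzero power_mult_neq_1) auto
  have card: "card B > 0" using assms by (simp add: card_gt_0_iff)
  have lhs: "(\<lambda>n. \<Sum>b\<in>B. infsum (f b n) UNIV) \<longlonglongrightarrow> 1 / (\<Prod>b\<in>B. qpoch_inf b q * qpoch_inf (q / b) q)"
  proof -
    have "(\<Sum>b\<in>B. infsum (f b n) UNIV) = 1 / (\<Prod>b\<in>B. qpoch b q (Suc n) * qpoch (q / b) q (Suc n))" for n
    proof -
      have "infsum (f b n) UNIV = (\<Sum>k\<in>R n. T b k /
          X b (nat (int (Suc n) - 1 - k)) (nat (int (Suc n) + k)) (nat (int (Suc n) - k)) (nat (int (Suc n) + k)))" for b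
      proof -
        have "infsum (f b n) UNIV = infsum (f b n) (R n)"
          by (intro infsum_cong_neutral) (auto simp: f_def)
        also have "\<dots> = sum (f b n) (R n)" by (simp add: R_def)
        finally show ?thesis by (simp add: f_def algebra_simps)
      qed
      then show ?thesis
        unfolding R_def T_def X_def lerch_term_def
        by (simp only:, subst finite_theta_partial_fractions) (use assms in auto)
    qed
    moreover have "(\<lambda>n. 1 / (\<Prod>b\<in>B. qpoch b q (Suc n) * qpoch (q / b) q (Suc n))) \<longlonglongrightarrow>
       1 / (\<Prod>b\<in>B. qpoch_inf b q * qpoch_inf (q / b) q)"
    proof (intro tendsto_intros LIMSEQ_Suc qpoch_tendsto assms(2))
      have "qpoch_inf b q \<noteq> 0" "qpoch_inf (q / b) q \<noteq> 0" if "b \<in> B" for b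
        using osB[OF that] assms(1,2) off_spiral_qpoch_inf_nonzero off_spiral_divide by blast+
      then show "(\<Prod>b\<in>B. qpoch_inf b q * qpoch_inf (q / b) q) \<noteq> 0" using assms(3) by simp
    qed
    ultimately show ?thesis by simp
  qed
  have rhs: "(\<lambda>n. infsum (f b n) UNIV) \<longlonglongrightarrow> lerch_sum (card B) (\<Prod>b'\<in>B. - (b / b')) b q / Y b" if b: "b \<in> B" for b
  proof -
    have os1: "off_spiral (b' / b) q" "off_spiral (q / (b' / b)) q" if "b' \<in> B - {b}" for b'
      using os[of b b'] b that off_spiral_divide[of "b' / b" q] assms(1) by auto
    have Y: "Y b \<noteq> 0"
      unfolding Y_def using qinf os1 assms(2,3) off_spiral_qpoch_inf_nonzero by auto
    obtain C where C: "C > 0" "\<And>n. norm (inverse (qpoch q q n)) \<le> C"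
      using inverse_qpoch_bounded[OF assms(2) power_mult_neq_1[OF assms(2,2)]] by metis
    have "\<forall>b'\<in>B-{b}. \<exists>D>0. \<forall>i j. norm (inverse (qpoch (b' / b) q i * qpoch (q / (b' / b)) q j)) \<le> D"
    proof
      fix b' assume "b' \<in> B - {b}"
      from rank_denominator_bounded[OF assms(2,1) os1(1)[OF this]]
      show "\<exists>D>0. \<forall>i j. norm (inverse (qpoch (b' / b) q i * qpoch (q / (b' / b)) q j)) \<le> D" by metis
    qed
    then obtain D where D: "\<And>b'. b' \<in> B - {b} \<Longrightarrow> D b' > 0"
      "\<And>b' i j. b' \<in> B - {b} \<Longrightarrow> norm (inverse (qpoch (b' / b) q i * qpoch (q / (b' / b)) q j)) \<le> D b'"
      by metis
    define K where "K = C * C * (\<Prod>b'\<in>B-{b}. D b')"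
    have K: "K \<ge> 0" unfolding K_def using C(1) D(1) by (intro mult_nonneg_nonneg prod_nonneg) (auto intro: less_imp_le)
    have Xb: "norm (inverse (X b i j i' j')) \<le> K" for i j i' j'
    proof -
      have "norm (inverse (X b i j i' j')) = norm (inverse (qpoch q q i)) * norm (inverse (qpoch q q j)) *
          (\<Prod>b'\<in>B-{b}. norm (inverse (qpoch (b' / b) q i' * qpoch (q / (b' / b)) q j')))"
        unfolding X_def prod_norm by (simp add: norm_mult norm_inverse prod_inversef[symmetric])
      also have "\<dots> \<le> K"
        unfolding K_def using C D by (intro mult_mono prod_mono prod_nonneg) (auto intro: less_imp_le)
      finally show ?thesis .
    qed
    have "(\<lambda>n. infsum (f b n) UNIV) \<longlonglongrightarrow> infsum (\<lambda>k. T b k * inverse (Y b)) UNIV"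
    proof (rule infsum_int_tannery)
      fix k
      have "(\<lambda>n. T b k / X b (nat (int n + - k)) (nat (int n + (1 + k))) (nat (int n + (1 - k))) (nat (int n + (1 + k))))
         \<longlonglongrightarrow> T b k / Y b"
        using Y unfolding X_def Y_def
        by (intro tendsto_intros qpoch_shift_tendsto assms(2)) auto
      moreover have "\<forall>\<^sub>F n in sequentially. f b n k =
         T b k / X b (nat (int n + - k)) (nat (int n + (1 + k))) (nat (int n + (1 - k))) (nat (int n + (1 + k)))"
        using eventually_ge_at_top[of "nat \<bar>k\<bar>"] by eventually_elim (auto simp: f_def R_def)
      ultimately show "(\<lambda>n. f b n k) \<longlonglongrightarrow> T b k * inverse (Y b)"
        by (simp add: tendsto_cong divide_inverse)
    next
      show "(\<lambda>k. norm (T b k) * K) summable_on UNIV"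
        unfolding T_def using assms nzB b osB card
        by (intro summable_on_cmult_left lerch_term_abs_summable) auto
      show "norm (f b n k) \<le> norm (T b k) * K" for n k
        using K Xb by (auto simp: f_def divide_inverse norm_mult intro!: mult_left_mono simp del: norm_inverse)
    qed
    then show ?thesis
      by (simp add: infsum_cmult_left' T_def lerch_sum_def divide_inverse)
  qed
  have "1 / (\<Prod>b\<in>B. qpoch_inf b q * qpoch_inf (q / b) q) = (\<Sum>b\<in>B. lerch_sum (card B) (\<Prod>b'\<in>B. - (b / b')) b q / Y b)"
    by (rule LIMSEQ_unique[OF lhs]) (intro tendsto_sum rhs)
  then have "qpoch_inf q q ^ 2 * (1 / (\<Prod>b\<in>B. qpoch_inf b q * qpoch_inf (q / b) q)) =
     (\<Sum>b\<in>B. qpoch_inf q q ^ 2 * (lerch_sum (card B) (\<Prod>b'\<in>B. - (b / b')) b q / Y b))"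
    by (simp only: sum_distrib_left)
  moreover have "qpoch_inf q q ^ 2 * (lerch_sum (card B) (\<Prod>b'\<in>B. - (b / b')) b q / Y b) =
     lerch_sum (card B) (\<Prod>b'\<in>B. - (b / b')) b q /
       (\<Prod>b'\<in>B-{b}. qpoch_inf (b' / b) q * qpoch_inf (q / (b' / b)) q)" for b
    using qinf by (simp add: Y_def power2_eq_square)
  ultimately show ?thesis by simp
qed

text \<open>Each term is expanded by partial fractions with the single spiral of \<open>x\<close>,
  and the order of summation is exchanged. The coefficient of 1 / (1 - x q^k) is then a Durfee
  series multiplied by q^(k^2 + a k), and \<open>tri k\<close> + k^2 + a k = 3 \<open>tri k\<close>
  + (a - 1) k: this is how level 1 becomes level 3.\<close>

lemma rank_sum_eq_lerch_sum:
  assumes "q \<noteq> 0" "norm q < 1" "x \<noteq> 0" "off_spiral x q" "a \<le> 1"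
  shows "rank_sum a x q = lerch_sum 3 (- (q powi (int a - 1))) x q / qpoch_inf q q"
proof -
  define c where "c = (\<lambda>k. (- 1) powi k * q powi tri k / (1 - x * q powi k))"
  define F where "F = (\<lambda>(n, k). if k \<in> {- int (n + a)..<int (n + 1)} then
     c k * (q ^ (n ^ 2 + a * n) / (qpoch q q (nat (int n - k)) * qpoch q q (nat (int n + int a + k)))) else 0)"
  obtain C where C: "C > 0" "\<And>n. norm (inverse (qpoch q q n)) \<le> C"
    using inverse_qpoch_bounded[OF assms(2) power_mult_neq_1[OF assms(2,2)]] by metis
  have c_sum: "(\<lambda>k. norm (c k)) summable_on UNIV"
    using lerch_term_abs_summable[of q "- 1" x 1] assms by (simp add: c_def lerch_term_def[abs_def])
  \<comment> \<open>The majorant is a product of a geometric series in \<open>n\<close> and a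
    summable function of \<open>k\<close>, so rows and columns may be exchanged.\<close>
  have F_sum: "F summable_on UNIV \<times> UNIV"
  proof (rule abs_summable_summable, rule Infinite_Sum.abs_summable_on_comparison_test')
    have geo: "(\<lambda>n. norm q ^ n * (C * C)) summable_on (UNIV :: nat set)"
      using assms C by (subst summable_on_UNIV_nonneg_real_iff) (auto intro!: summable_mult2 summable_geometric)
    show "(\<lambda>(n, k). norm q ^ n * (C * C) * norm (c k)) summable_on UNIV \<times> (UNIV :: int set)"
    proof (rule summable_on_SigmaI)
      show "((\<lambda>k. case (n, k) of (n, k) \<Rightarrow> norm q ^ n * (C * C) * norm (c k)) has_sum
         norm q ^ n * (C * C) * (\<Sum>\<^sub>\<infinity>k. norm (c k))) UNIV" for n
        using has_sum_cmult_right[OF has_sum_infsum[OF c_sum]] by simp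
      show "(\<lambda>n. norm q ^ n * (C * C) * (\<Sum>\<^sub>\<infinity>k. norm (c k))) summable_on UNIV"
        by (intro summable_on_cmult_left geo)
    qed (use C in auto)
    fix p :: "nat \<times> int"
    obtain n k where p: "p = (n, k)" by force
    have "norm (c k * (q ^ (n ^ 2 + a * n) / (qpoch q q i * qpoch q q j))) \<le> norm q ^ n * (C * C) * norm (c k)" for i j
      unfolding divide_inverse norm_mult inverse_mult_distrib norm_power
        mult.commute[of "norm (c k)"]
      using C assms by (intro mult_right_mono mult_mono power_square_le) (auto simp del: norm_inverse intro: less_imp_le)
    moreover have "norm q ^ n * (C * C) * norm (c k) \<ge> 0" using C by simp
    ultimately show "norm (F p) \<le> (case p of (n, k) \<Rightarrow> norm q ^ n * (C * C) * norm (c k))"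
      by (simp add: F_def p del: norm_mult norm_inverse)
  qed
  have row: "((\<lambda>k. F (n, k)) has_sum rank_term a x q n) UNIV" for n
  proof -
    have "1 / (qpoch x q (n + 1) * qpoch (q / x) q (n + a)) =
       (\<Sum>k\<in>{- int (n + a)..<int (n + 1)}. c k / (qpoch q q (nat (int n - k)) * qpoch q q (nat (int n + int a + k))))"
      using finite_theta_partial_fractions[of q "{x}" "n + 1" "n + a"] assms by (simp add: c_def)
    then have "rank_term a x q n = (\<Sum>k\<in>{- int (n + a)..<int (n + 1)}. F (n, k))"
      unfolding rank_term_def divide_inverse[of "q ^ _" "_ * qpoch (q / x) q (n + a)"] inverse_eq_divide
      by (simp add: sum_distrib_left F_def mult_ac)
    then show ?thesis
      by (intro has_sum_finite_neutralI[of "{- int (n + a)..<int (n + 1)}"]) (auto simp: F_def)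
  qed
  have col: "((\<lambda>n. F (n, k)) has_sum lerch_term 3 (- (q powi (int a - 1))) x q k / qpoch_inf q q) UNIV" for k
  proof -
    \<comment> \<open>The first row \<open>n\<close> whose window contains \<open>k\<close>; the
      Durfee index is r = n - j. For negative \<open>k\<close> the difference -a - k is nonnegative
      because a is at most 1. Passing from k to -a - k only swaps the two symbols in the
      denominator.\<close>
    define j where "j = (if k \<ge> 0 then nat k else nat (- int a - k))"
    have jk: "k = int j \<or> k = - int a - int j" using assms(5) by (auto simp: j_def)
    have durfee: "((\<lambda>r. q ^ (r ^ 2 + (2 * j + a) * r) / (qpoch q q r * qpoch q q (r + (2 * j + a)))) has_sum (1 / qpoch_inf q q)) UNIV"
    proof (rule norm_summable_imp_has_sum[OF _ durfee_identity[OF assms(2)]])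
      show "summable (\<lambda>r. norm (q ^ (r ^ 2 + (2 * j + a) * r) / (qpoch q q r * qpoch q q (r + (2 * j + a)))))"
      proof (rule summable_comparison_test')
        show "summable (\<lambda>n. norm q ^ n * (C * C))" using assms by (intro summable_mult2 summable_geometric) auto
        show "norm (norm (q ^ (r ^ 2 + (2 * j + a) * r) / (qpoch q q r * qpoch q q (r + (2 * j + a))))) \<le> norm q ^ r * (C * C)" for r
          unfolding real_norm_def abs_norm_cancel unfolding divide_inverse norm_mult inverse_mult_distrib norm_power
          using C assms by (intro mult_mono power_square_le) (auto simp del: norm_inverse intro: less_imp_le)
      qed
    qed
    have jexp: "int (j ^ 2 + a * j) = k ^ 2 + int a * k"
      unfolding of_nat_add of_nat_mult of_nat_power using jk
    proof
      assume k: "k = - int a - int j"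
      show "int j ^ 2 + int a * int j = k ^ 2 + int a * k"
        unfolding k by (simp add: power2_eq_square algebra_simps)
    qed simp
    have coeff: "c k * q ^ (j ^ 2 + a * j) = lerch_term 3 (- (q powi (int a - 1))) x q k"
    proof -
      have "tri k + (k ^ 2 + int a * k) = (int a - 1) * k + 3 * tri k"
        using double_tri[of k] by (simp add: power2_eq_square algebra_simps)
      then have "q powi tri k * q powi (k ^ 2 + int a * k) = (q powi (int a - 1)) powi k * q powi (3 * tri k)"
        by (simp only: power_int_add [OF disjI1 [OF assms(1)], symmetric] power_int_mult [symmetric])
      moreover have "q ^ (j ^ 2 + a * j) = q powi (k ^ 2 + int a * k)"
        unfolding jexp [symmetric] by (simp only: power_int_of_nat)
      moreover have "(- (q powi (int a - 1))) powi k = (- 1) powi k * (q powi (int a - 1)) powi k"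
        using power_int_mult_distrib[of "- 1" "q powi (int a - 1)" k] by simp
      ultimately show ?thesis by (simp add: c_def lerch_term_def mult_ac)
    qed
    have val: "F (r + j, k) = lerch_term 3 (- (q powi (int a - 1))) x q k *
       (q ^ (r ^ 2 + (2 * j + a) * r) / (qpoch q q r * qpoch q q (r + (2 * j + a))))" for r
    proof -
      have e: "(r + j) ^ 2 + a * (r + j) = (j ^ 2 + a * j) + (r ^ 2 + (2 * j + a) * r)"
        by (simp add: power2_eq_square algebra_simps)
      have kin: "k \<in> {- int (r + j + a)..<int (r + j + 1)}" using jk by auto
      have "qpoch q q (nat (int (r + j) - k)) * qpoch q q (nat (int (r + j) + int a + k)) =
          qpoch q q r * qpoch q q (r + (2 * j + a))"
      proof (cases "k = int j")
        case True
        then have "nat (int (r + j) - k) = r" "nat (int (r + j) + int a + k) = r + (2 * j + a)" by auto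
        then show ?thesis by simp
      next
        case False
        then have "nat (int (r + j) - k) = r + (2 * j + a)" "nat (int (r + j) + int a + k) = r" using jk by auto
        then show ?thesis by simp
      qed
      then show ?thesis using kin by (simp add: F_def e power_add coeff [symmetric])
    qed
    have "((\<lambda>r. F (r + j, k)) has_sum (lerch_term 3 (- (q powi (int a - 1))) x q k * (1 / qpoch_inf q q))) UNIV"
      unfolding val by (rule has_sum_cmult_right[OF durfee])
    then have "((\<lambda>n. F (n, k)) has_sum (lerch_term 3 (- (q powi (int a - 1))) x q k * (1 / qpoch_inf q q))) {j..}"
      by (subst has_sum_reindex_bij_witness[of _ "\<lambda>r. r + j" "\<lambda>n. n - j" UNIV "\<lambda>r. F (r + j, k)"]) auto
    also have "?this \<longleftrightarrow> ((\<lambda>n. F (n, k)) has_sum (lerch_term 3 (- (q powi (int a - 1))) x q k * (1 / qpoch_inf q q))) UNIV"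
      by (intro has_sum_cong_neutral) (use jk in \<open>auto simp: F_def\<close>)
    finally show ?thesis by simp
  qed
  obtain S where S: "(F has_sum S) (UNIV \<times> UNIV)" using F_sum by (auto simp: summable_on_def)
  have "(rank_term a x q has_sum S) UNIV"
    using has_sum_SigmaD[OF S] row by blast
  then have 1: "rank_sum a x q = S"
    unfolding rank_sum_def using has_sum_imp_sums sums_unique by metis
  have "((\<lambda>(k, n). F (n, k)) has_sum S) (UNIV \<times> UNIV)"
    using S by (subst (asm) has_sum_swap)
  then have "((\<lambda>k. lerch_term 3 (- (q powi (int a - 1))) x q k / qpoch_inf q q) has_sum S) UNIV"
    by (rule has_sum_SigmaD) (use col in auto)
  then have "S = (\<Sum>\<^sub>\<infinity>k. lerch_term 3 (- (q powi (int a - 1))) x q k * inverse (qpoch_inf q q))"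
    by (simp add: divide_inverse infsumI)
  then show ?thesis
    unfolding 1 lerch_sum_def by (simp add: infsum_cmult_left' divide_inverse)
qed

text \<open>Substitute -k for k. With y = q^k, the \<open>tri\<close> exponent contributes y^(-3)
  and the denominator x y up to sign, which leaves y^(-2) for the new weight.\<close>

lemma lerch_sum_inverse:
  assumes "q \<noteq> 0" "norm q < 1" "x \<noteq> 0" "w \<noteq> 0" "off_spiral x q"
  shows "lerch_sum 3 w (1 / x) q = - x * lerch_sum 3 (inverse (w * q ^ 2)) x q"
proof -
  have eq: "lerch_term 3 w (1 / x) q (- k) = - x * lerch_term 3 (inverse (w * q ^ 2)) x q k" for k
  proof -
    define y where "y = q powi k"
    have nz: "y \<noteq> 0" "1 - x * y \<noteq> 0"
      using assms by (auto simp: y_def off_spiral_def)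
    have "int 3 * tri (- k) = int 3 * tri k - k * int 3" by (simp add: tri_minus)
    then have "q powi (int 3 * tri (- k)) = q powi (int 3 * tri k) / y ^ 3"
      unfolding y_def using assms(1) by (simp only: power_int_diff[OF disjI1[OF assms(1)]] power_int_mult power_int_of_nat)
    moreover have "inverse (w * q ^ 2) powi k = w powi (- k) / y ^ 2"
      unfolding y_def using assms by (simp add: power_int_mult_distrib power_int_inverse power_int_minus field_simps power_int_mult [symmetric] mult.commute power_int_power power_int_power')
    moreover have "q powi (- k) = inverse y" by (simp add: y_def power_int_minus)
    ultimately have "lerch_term 3 w (1 / x) q (- k) = w powi (- k) * (q powi (int 3 * tri k) / y ^ 3) / (1 - 1 / x * inverse y)"
        and "lerch_term 3 (inverse (w * q ^ 2)) x q k = w powi (- k) / y ^ 2 * q powi (int 3 * tri k) / (1 - x * y)"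
      by (simp_all only: lerch_term_def y_def)
    moreover have "u * (v / y ^ 3) / (1 - 1 / x * inverse y) = - x * (u / y ^ 2 * v / (1 - x * y))" for u v
    proof -
      have "1 - 1 / x * inverse y = - (1 - x * y) / (x * y)" using nz assms(3) by (simp add: field_simps)
      then show ?thesis using nz assms(3) by (simp add: field_simps power2_eq_square power3_eq_cube)
    qed
    ultimately show ?thesis by simp
  qed
  have "lerch_sum 3 w (1 / x) q = (\<Sum>\<^sub>\<infinity>k. - x * lerch_term 3 (inverse (w * q ^ 2)) x q k)"
    unfolding lerch_sum_def
    by (intro infsum_reindex_bij_witness[of _ uminus uminus]) (use eq[of "- k" for k] in auto)
  then show ?thesis
    unfolding lerch_sum_def by (simp only: infsum_cmult_right')
qed

lemma infsum_int_parity: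
  fixes f :: "int \<Rightarrow> 'a :: banach"
  assumes "f summable_on UNIV"
  shows "infsum f UNIV = (\<Sum>\<^sub>\<infinity>m. f (2 * m)) + (\<Sum>\<^sub>\<infinity>m. f (2 * m + 1))"
proof -
  have U: "UNIV = range (\<lambda>m::int. 2 * m) \<union> range (\<lambda>m. 2 * m + 1)"
    by (auto simp: image_iff) presburger
  have "range (\<lambda>m::int. 2 * m) \<inter> range (\<lambda>m. 2 * m + 1) = {}" by auto presburger
  then have "infsum f UNIV = infsum f (range (\<lambda>m::int. 2 * m)) + infsum f (range (\<lambda>m. 2 * m + 1))"
    by (subst U, intro infsum_Un_disjoint summable_on_subset_banach[OF assms]) auto
  then show ?thesis
    by (simp add: infsum_reindex inj_on_def o_def)
qed

text \<open>Adding the terms at x and -x gives 2 / (1 - x^2 q^(2k)); splitting \<open>k\<close> by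
  parity then yields poles on two spirals with base q^4, starting at x^2 and at x^2 q^2.\<close>

lemma lerch_sum_even_part:
  assumes "q \<noteq> 0" "norm q < 1" "x \<noteq> 0" "w \<noteq> 0" "off_spiral x q" "off_spiral (- x) q"
  shows "lerch_sum 3 w x q + lerch_sum 3 w (- x) q =
    2 * (lerch_sum 3 (w ^ 2 / q ^ 3) (x ^ 2) (q ^ 4) + q ^ 3 * w * lerch_sum 3 (q ^ 3 * w ^ 2) (x ^ 2 * q ^ 2) (q ^ 4))"
proof -
  define h where "h = (\<lambda>k. w powi k * q powi (3 * tri k) / (1 - x ^ 2 * (q powi k) ^ 2))"
  have nz: "x * q powi k \<noteq> 1" "x * q powi k \<noteq> - 1" for k
    using assms(5,6) unfolding off_spiral_def by (metis, metis minus_minus mult_minus_left)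
  have sum: "lerch_term 3 w x q k + lerch_term 3 w (- x) q k = 2 * h k" for k
  proof -
    have "1 - x * q powi k \<noteq> 0" "1 + x * q powi k \<noteq> 0"
      using nz[of k] by (auto simp: add_eq_0_iff)
    moreover have "1 - x ^ 2 * (q powi k) ^ 2 = (1 - x * q powi k) * (1 + x * q powi k)"
      by (simp add: power2_eq_square algebra_simps)
    ultimately show ?thesis
      by (simp add: lerch_term_def h_def divide_simps) (simp add: algebra_simps)
  qed
  have s1: "lerch_term 3 w x q summable_on UNIV" "lerch_term 3 w (- x) q summable_on UNIV"
    using lerch_term_summable assms by auto
  have "(\<lambda>k. 2 * h k) summable_on UNIV"
    using summable_on_add[OF s1] by (simp add: sum)
  then have h_sum: "h summable_on UNIV"
    using summable_on_cmult_right[of "\<lambda>k. 2 * h k" UNIV "1 / 2"] by simp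
  have h_even: "h (2 * m) = lerch_term 3 (w ^ 2 / q ^ 3) (x ^ 2) (q ^ 4) m" for m
  proof -
    have "2 * (3 * tri (2 * m)) = 2 * (4 * (3 * tri m) - 3 * m)"
      using double_tri[of "2 * m"] double_tri[of m] by (simp add: algebra_simps)
    then have e: "3 * tri (2 * m) = 4 * (3 * tri m) - 3 * m" by simp
    have "q powi (3 * tri (2 * m)) = (q ^ 4) powi (int 3 * tri m) / (q ^ 3) powi m"
      unfolding e power_int_diff[OF disjI1[OF assms(1)]] power_int_power by simp
    moreover have "w powi (2 * m) = (w ^ 2) powi m" by (simp add: power_int_power)
    moreover have "(q powi (2 * m)) ^ 2 = (q ^ 4) powi m"
      unfolding power_int_power power_int_power' by (simp add: mult_ac)
    ultimately show ?thesis by (simp add: h_def lerch_term_def power_int_divide_distrib)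
  qed
  have h_odd: "h (2 * m + 1) = q ^ 3 * w * lerch_term 3 (q ^ 3 * w ^ 2) (x ^ 2 * q ^ 2) (q ^ 4) m" for m
  proof -
    have "2 * (3 * tri (2 * m + 1)) = 2 * (4 * (3 * tri m) + 3 * m + 3)"
      using double_tri[of "2 * m + 1"] double_tri[of m] by (simp add: algebra_simps)
    then have e: "3 * tri (2 * m + 1) = 4 * (3 * tri m) + 3 * m + 3" by simp
    have "q powi (3 * tri (2 * m + 1)) = (q ^ 4) powi (int 3 * tri m) * (q ^ 3) powi m * q ^ 3"
      unfolding e power_int_add[OF disjI1[OF assms(1)]] power_int_power by simp
    moreover have "w powi (2 * m + 1) = (w ^ 2) powi m * w"
      using assms(4) by (simp add: power_int_power power_int_add)
    moreover have "(q powi (2 * m + 1)) ^ 2 = q ^ 2 * (q ^ 4) powi m"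
    proof -
      have "(q powi (2 * m + 1)) ^ 2 = q ^ 2 * (q powi (2 * m)) ^ 2"
        using assms(1) by (simp add: power_int_add power_mult_distrib)
      also have "(q powi (2 * m)) ^ 2 = (q ^ 4) powi m"
        unfolding power_int_power power_int_power' by (simp add: mult_ac)
      finally show ?thesis .
    qed
    ultimately show ?thesis by (simp add: h_def lerch_term_def power_int_mult_distrib mult_ac)
  qed
  have "lerch_sum 3 w x q + lerch_sum 3 w (- x) q = (\<Sum>\<^sub>\<infinity>k. 2 * h k)"
    unfolding lerch_sum_def by (subst infsum_add[OF s1, symmetric]) (simp add: sum)
  also have "\<dots> = 2 * infsum h UNIV" by (rule infsum_cmult_right')
  also have "infsum h UNIV = (\<Sum>\<^sub>\<infinity>m. h (2 * m)) + (\<Sum>\<^sub>\<infinity>m. h (2 * m + 1))"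
    by (rule infsum_int_parity[OF h_sum])
  finally show ?thesis
    unfolding lerch_sum_def by (simp only: h_even h_odd infsum_cmult_right')
qed

text \<open>With y = q^k, the difference of 1/(1 - x y) and 1/(1 + x y) is x y times their sum; the
  factor y changes the weight from w to w q. This reduces the difference to
  \<open>lerch_sum_even_part\<close>.\<close>

lemma lerch_sum_odd_part:
  assumes "q \<noteq> 0" "norm q < 1" "x \<noteq> 0" "w \<noteq> 0" "off_spiral x q" "off_spiral (- x) q"
  shows "lerch_sum 3 w x q - lerch_sum 3 w (- x) q =
    x * (lerch_sum 3 (w * q) x q + lerch_sum 3 (w * q) (- x) q)"
proof -
  have "lerch_term 3 w x q k = lerch_term 3 w (- x) q k +
     x * (lerch_term 3 (w * q) x q k + lerch_term 3 (w * q) (- x) q k)" for k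
  proof -
    have "x * q powi k \<noteq> 1" "x * q powi k \<noteq> - 1"
      using assms(5,6) unfolding off_spiral_def by (metis, metis minus_minus mult_minus_left)
    then have "1 - x * q powi k \<noteq> 0" "1 + x * q powi k \<noteq> 0"
      by (auto simp: add_eq_0_iff)
    then show ?thesis
      by (simp add: lerch_term_def power_int_mult_distrib divide_simps) (simp add: algebra_simps)
  qed
  then have "lerch_sum 3 w x q = (\<Sum>\<^sub>\<infinity>k. lerch_term 3 w (- x) q k +
      x * (lerch_term 3 (w * q) x q k + lerch_term 3 (w * q) (- x) q k))" by (simp add: lerch_sum_def)
  moreover have "lerch_term 3 v x q summable_on UNIV" "lerch_term 3 v (- x) q summable_on UNIV" if "v \<noteq> 0" for v
    using lerch_term_summable assms that by auto
  ultimately show ?thesis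
    using assms(1,4) unfolding lerch_sum_def by (simp add: infsum_add infsum_cmult_right' summable_on_add summable_on_cmult_right)
qed

section \<open>Theta functions with base q^8\<close>

text \<open>Taking norms, a power of \<open>q\<close> has norm 1 only if its exponent is 0, and
  \<open>i\<close> is not a multiple of \<open>m\<close>.\<close>

lemma off_spiral_powi:
  assumes "q \<noteq> 0" "norm q < 1" "norm c = 1" "\<not> int m dvd i"
  shows "off_spiral (c * q powi i) (q ^ m)"
  unfolding off_spiral_def
proof
  fix k :: int
  show "c * q powi i * (q ^ m) powi k \<noteq> 1"
  proof
    assume h: "c * q powi i * (q ^ m) powi k = 1"
    have "q powi i * (q ^ m) powi k = q powi (i + int m * k)"
      using assms(1) by (simp add: power_int_add power_int_power)
    then have "norm q powi (i + int m * k) = norm (c * q powi i * (q ^ m) powi k)"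
      using assms(3) by (simp add: norm_mult norm_power_int mult.assoc)
    also have "\<dots> = 1" unfolding h by simp
    finally have n: "norm q powi (i + int m * k) = 1" .
    have "i + int m * k \<noteq> 0"
    proof
      assume "i + int m * k = 0"
      then have "i = int m * (- k)" by simp
      with assms(4) show False by auto
    qed
    with n show False
      using assms(1,2) power_int_strict_decreasing[of 0 "i + int m * k" "norm q"]
        power_int_strict_decreasing[of "i + int m * k" 0 "norm q"]
      by (cases "i + int m * k > 0") auto
  qed
qed

lemma off_spiral_power_mult:
  assumes "q \<noteq> 0" "norm q < 1" "\<not> m dvd i"
  shows "off_spiral (q ^ i) (q ^ m)" "off_spiral (- (q ^ i)) (q ^ m)"
    and "off_spiral (1 / q ^ i) (q ^ m)" "off_spiral (- (1 / q ^ i)) (q ^ m)"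
  using off_spiral_powi[OF assms(1,2), of 1 m "int i"] off_spiral_powi[OF assms(1,2), of "- 1" m "int i"]
    off_spiral_powi[OF assms(1,2), of 1 m "- int i"] off_spiral_powi[OF assms(1,2), of "- 1" m "- int i"] assms(3)
  by (auto simp: power_int_minus divide_inverse)

text \<open>\<open>theta_j\<close> without its last factor \<open>qpoch_inf q q\<close>: in the
  partial fractions these factors are already collected in the numerator.\<close>

definition theta_bracket :: "complex \<Rightarrow> complex \<Rightarrow> complex" where
  "theta_bracket z q = qpoch_inf z q * qpoch_inf (q / z) q"

lemma theta_j_eq_bracket: "theta_j z q = theta_bracket z q * qpoch_inf q q"
  by (simp add: theta_j_def theta_bracket_def)

lemma theta_bracket_nonzero:
  assumes "q \<noteq> 0" "norm q < 1" "off_spiral z q"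
  shows "theta_bracket z q \<noteq> 0"
  unfolding theta_bracket_def
  using assms off_spiral_qpoch_inf_nonzero off_spiral_divide by auto

lemma theta_bracket_reflect:
  assumes "q \<noteq> 0" "z \<noteq> 0"
  shows "theta_bracket (q / z) q = theta_bracket z q"
  using assms by (simp add: theta_bracket_def)

text \<open>Splitting off the first factor on each side leaves the same two products, and 1 - 1/z =
  -(1 - z)/z.\<close>

lemma theta_bracket_inverse:
  assumes "norm q < 1" "z \<noteq> 0"
  shows "theta_bracket (1 / z) q = - (theta_bracket z q / z)"
proof -
  have "qpoch_inf z q = (1 - z) * qpoch_inf (q * z) q" "qpoch_inf (1 / z) q = (1 - 1 / z) * qpoch_inf (q / z) q"
    using qpoch_inf_shift[OF assms(1), of z] qpoch_inf_shift[OF assms(1), of "1 / z"] by simp_all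
  moreover have "q / (1 / z) = q * z" by simp
  ultimately show ?thesis
    unfolding theta_bracket_def by (simp only:) (use assms(2) in \<open>simp add: field_simps\<close>)
qed

lemma theta_partial_fractions_3:
  assumes "q \<noteq> 0" "norm q < 1" "b1 \<noteq> 0" "b2 \<noteq> 0" "b3 \<noteq> 0"
    "off_spiral b1 q" "off_spiral b2 q" "off_spiral b3 q"
    "off_spiral (b2 / b1) q" "off_spiral (b3 / b1) q" "off_spiral (b1 / b2) q"
    "off_spiral (b3 / b2) q" "off_spiral (b1 / b3) q" "off_spiral (b2 / b3) q"
  shows "qpoch_inf q q ^ 2 / (theta_bracket b1 q * theta_bracket b2 q * theta_bracket b3 q) =
    lerch_sum 3 (- (b1 ^ 2 / (b2 * b3))) b1 q / (theta_bracket (b2 / b1) q * theta_bracket (b3 / b1) q) +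
    lerch_sum 3 (- (b2 ^ 2 / (b1 * b3))) b2 q / (theta_bracket (b1 / b2) q * theta_bracket (b3 / b2) q) +
    lerch_sum 3 (- (b3 ^ 2 / (b1 * b2))) b3 q / (theta_bracket (b1 / b3) q * theta_bracket (b2 / b3) q)"
proof -
  \<comment> \<open>1 is the power with k = 0, so two equal parameters would violate the condition
    on their quotient.\<close>
  have "\<not> off_spiral 1 q" by (auto simp: off_spiral_def intro: exI[of _ 0])
  then have ne: "b1 \<noteq> b2" "b1 \<noteq> b3" "b2 \<noteq> b3" using assms by auto
  let ?B = "{b1, b2, b3}"
  have del: "?B - {b1} = {b2, b3}" "?B - {b2} = {b1, b3}" "?B - {b3} = {b1, b2}" using ne by auto
  have w: "(\<Prod>b'\<in>?B. - (b / b')) = - (b ^ 3 / (b1 * b2 * b3))" for b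
    using ne by (simp add: power3_eq_cube mult.assoc)
  have w': "- (b1 ^ 3 / (b1 * b2 * b3)) = - (b1 ^ 2 / (b2 * b3))" "- (b2 ^ 3 / (b1 * b2 * b3)) = - (b2 ^ 2 / (b1 * b3))"
    "- (b3 ^ 3 / (b1 * b2 * b3)) = - (b3 ^ 2 / (b1 * b2))"
    using assms(3-5) by (simp_all add: power3_eq_cube power2_eq_square)
  have "qpoch_inf q q ^ 2 / (\<Prod>b\<in>?B. qpoch_inf b q * qpoch_inf (q / b) q) =
    (\<Sum>b\<in>?B. lerch_sum (card ?B) (\<Prod>b'\<in>?B. - (b / b')) b q /
       (\<Prod>b'\<in>?B-{b}. qpoch_inf (b' / b) q * qpoch_inf (q / (b' / b)) q))"
    by (rule theta_partial_fractions) (use assms in auto)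
  moreover have "card ?B = 3" using ne by simp
  moreover have "sum f ?B = f b1 + f b2 + f b3" "prod f ?B = f b1 * f b2 * f b3" for f :: "complex \<Rightarrow> complex"
    using ne by (simp_all add: add.assoc mult.assoc)
  moreover have "prod f {b2, b3} = f b2 * f b3" "prod f {b1, b3} = f b1 * f b3" "prod f {b1, b2} = f b1 * f b2"
    for f :: "complex \<Rightarrow> complex"
    using ne by simp_all
  ultimately show ?thesis
    unfolding w theta_bracket_def [symmetric] by (simp only: del w')
qed

section \<open>Infinite products for the brackets at powers of q\<close>

context
  fixes q :: complex
  assumes q0: "q \<noteq> 0" and q1: "norm q < 1"
begin

lemma norm_qpow: "m > 0 \<Longrightarrow> norm (q ^ m) < 1"
  using q1 by (simp add: norm_power power_less_one_iff)

text \<open>\<open>theta_J1 2\<close> is encoded as a theta function with base q^6; its three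
  factors are the residue classes modulo 3 of the product on the right.\<close>

lemma theta_J1_2: "theta_J1 2 q = qpoch_inf (q ^ 2) (q ^ 2)"
proof -
  have "qpoch_inf (q ^ 2) (q ^ 2) = (\<Prod>r<3. qpoch_inf ((q ^ 2) ^ r * q ^ 2) ((q ^ 2) ^ 3))"
    by (rule qpoch_inf_dissect) (use norm_qpow in auto)
  also have "\<dots> = qpoch_inf (q ^ 2) (q ^ 6) * qpoch_inf (q ^ 4) (q ^ 6) * qpoch_inf (q ^ 6) (q ^ 6)"
    by (simp add: lessThan_nat_numeral lessThan_Suc mult_ac)
  finally have e: "qpoch_inf (q ^ 2) (q ^ 2) = \<dots>" .
  have "q ^ 6 / q ^ 2 = q ^ 4" using q0 by (simp add: eval_nat_numeral)
  then show ?thesis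
    by (simp add: theta_J1_def theta_J_def theta_j_def e)
qed

lemma bracket_q2: "theta_bracket (- (q ^ 2)) (q ^ 8) = qpoch_inf (- (q ^ 2)) (q ^ 4)"
proof -
  have "qpoch_inf (- (q ^ 2)) (q ^ 4) = (\<Prod>r<2. qpoch_inf ((q ^ 4) ^ r * - (q ^ 2)) ((q ^ 4) ^ 2))"
    by (rule qpoch_inf_dissect) (use norm_qpow in auto)
  moreover have "q ^ 8 / q ^ 2 = q ^ 6" using q0 by (simp add: eval_nat_numeral)
  ultimately show ?thesis by (simp add: theta_bracket_def lessThan_nat_numeral lessThan_Suc mult_ac)
qed

text \<open>The exponents 1, 7 and 3, 5 of the two brackets together are the odd residues modulo 8;
  1/e = e keeps the sign uniform.\<close>

lemma bracket_odd:
  assumes "e = 1 \<or> e = - 1"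
  shows "theta_bracket (e * q) (q ^ 8) * theta_bracket (e * q ^ 3) (q ^ 8) = qpoch_inf (e * q) (q ^ 2)"
proof -
  have "qpoch_inf (e * q) (q ^ 2) = (\<Prod>r<4. qpoch_inf ((q ^ 2) ^ r * (e * q)) ((q ^ 2) ^ 4))"
    by (rule qpoch_inf_dissect) (use norm_qpow in auto)
  moreover have "q ^ 8 / (e * q) = e * q ^ 7" "q ^ 8 / (e * q ^ 3) = e * q ^ 5"
    using q0 assms by (auto simp: eval_nat_numeral)
  moreover have "(q ^ 2) ^ 4 = q ^ 8" "q ^ 2 * (e * q) = e * q ^ 3" "(q ^ 2) ^ 2 * (e * q) = e * q ^ 5" "(q ^ 2) ^ 3 * (e * q) = e * q ^ 7"
    by (simp_all add: eval_nat_numeral mult_ac)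
  moreover have "q * q ^ 2 = q ^ 3" "q * q ^ 4 = q ^ 5" "q * q ^ 6 = q ^ 7"
    by (simp_all add: eval_nat_numeral)
  ultimately show ?thesis
    by (simp add: theta_bracket_def lessThan_nat_numeral lessThan_Suc mult_ac)
qed

lemma bracket_q4: "theta_bracket (q ^ 4) (q ^ 8) = qpoch_inf (q ^ 4) (q ^ 8) ^ 2"
proof -
  have "q ^ 8 / q ^ 4 = q ^ 4" using q0 by (simp add: eval_nat_numeral)
  then show ?thesis by (simp add: theta_bracket_def power2_eq_square)
qed

lemma theta_Jbar_2_4: "theta_Jbar 2 4 q = qpoch_inf (- (q ^ 2)) (q ^ 4) ^ 2 * qpoch_inf (q ^ 4) (q ^ 4)"
proof -
  have "q ^ 4 / q ^ 2 = q ^ 2" using q0 by (simp add: eval_nat_numeral)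
  then show ?thesis by (simp add: theta_Jbar_def theta_j_def power2_eq_square)
qed

lemma theta_Jbar_1_8: "theta_Jbar 1 8 q = theta_bracket (- q) (q ^ 8) * qpoch_inf (q ^ 8) (q ^ 8)"
  and theta_Jbar_3_8: "theta_Jbar 3 8 q = theta_bracket (- (q ^ 3)) (q ^ 8) * qpoch_inf (q ^ 8) (q ^ 8)"
  by (simp_all add: theta_Jbar_def theta_j_eq_bracket)

lemma qpoch_inf_factors:
  "qpoch_inf q (q ^ 2) * qpoch_inf (- q) (q ^ 2) = qpoch_inf (q ^ 2) (q ^ 4)"
  "qpoch_inf (q ^ 2) (q ^ 4) * qpoch_inf (- (q ^ 2)) (q ^ 4) = qpoch_inf (q ^ 4) (q ^ 8)"
  "qpoch_inf (q ^ 4) (q ^ 4) = qpoch_inf (q ^ 4) (q ^ 8) * qpoch_inf (q ^ 8) (q ^ 8)"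
  "qpoch_inf (q ^ 2) (q ^ 2) = qpoch_inf (q ^ 2) (q ^ 4) * qpoch_inf (q ^ 4) (q ^ 4)"
proof -
  show "qpoch_inf q (q ^ 2) * qpoch_inf (- q) (q ^ 2) = qpoch_inf (q ^ 2) (q ^ 4)"
    using qpoch_inf_mult_minus[of "q ^ 2" q] norm_qpow by simp
  show "qpoch_inf (q ^ 2) (q ^ 4) * qpoch_inf (- (q ^ 2)) (q ^ 4) = qpoch_inf (q ^ 4) (q ^ 8)"
    using qpoch_inf_mult_minus[of "q ^ 4" "q ^ 2"] norm_qpow by simp
  show "qpoch_inf (q ^ 4) (q ^ 4) = qpoch_inf (q ^ 4) (q ^ 8) * qpoch_inf (q ^ 8) (q ^ 8)"
    using qpoch_inf_dissect[of "q ^ 4" 2 "q ^ 4"] norm_qpow by (simp add: lessThan_nat_numeral lessThan_Suc mult_ac)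
  show "qpoch_inf (q ^ 2) (q ^ 2) = qpoch_inf (q ^ 2) (q ^ 4) * qpoch_inf (q ^ 4) (q ^ 4)"
    using qpoch_inf_dissect[of "q ^ 2" 2 "q ^ 2"] norm_qpow by (simp add: lessThan_nat_numeral lessThan_Suc mult_ac)
qed

text \<open>Both sides equal (q^4;q^8)^2 (q^8;q^8), all symbols infinite. It gives the quotient of
  brackets in front of the third Lerch sum the value that \<open>mock_g\<close> requires.\<close>

lemma bracket_ratio:
  "theta_bracket (q ^ 4) (q ^ 8) * qpoch_inf (q ^ 8) (q ^ 8) = qpoch_inf (q ^ 2) (q ^ 2) * theta_bracket (- (q ^ 2)) (q ^ 8)"
  unfolding bracket_q4 bracket_q2 qpoch_inf_factors(3,4) qpoch_inf_factors(2) [symmetric]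
  by (simp add: power2_eq_square mult_ac)

lemma bracket_q5: "theta_bracket (q ^ 5) (q ^ 8) = theta_bracket (q ^ 3) (q ^ 8)"
proof -
  have "q ^ 8 / q ^ 3 = q ^ 5" using q0 by (simp add: eval_nat_numeral)
  then show ?thesis using theta_bracket_reflect[of "q ^ 8" "q ^ 3"] q0 by simp
qed

text \<open>Turns a reciprocal product of three brackets into \<open>theta_Jbar 2 4\<close> times
  the one bracket that is missing on the right. With b3 = -q^3 the missing one is at -q, which gives
  \<open>theta_Jbar 1 8\<close>; with b3 = -1/q it is at -q^3, which gives
  \<open>theta_Jbar 3 8\<close>.\<close>

lemma bracket_product:
  "theta_bracket (q ^ 4) (q ^ 8) * theta_bracket (- (q ^ 2)) (q ^ 8) * qpoch_inf (q ^ 8) (q ^ 8) =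
    theta_Jbar 2 4 q * (theta_bracket q (q ^ 8) * theta_bracket (q ^ 5) (q ^ 8) *
      (theta_bracket (- q) (q ^ 8) * theta_bracket (- (q ^ 3)) (q ^ 8)))"
proof -
  have "theta_bracket q (q ^ 8) * theta_bracket (q ^ 5) (q ^ 8) *
      (theta_bracket (- q) (q ^ 8) * theta_bracket (- (q ^ 3)) (q ^ 8)) = qpoch_inf (q ^ 2) (q ^ 4)"
    using bracket_odd[of 1] bracket_odd[of "- 1"] qpoch_inf_factors(1) by (simp add: bracket_q5)
  then show ?thesis
    unfolding theta_Jbar_2_4 bracket_q4 bracket_q2 qpoch_inf_factors(3) qpoch_inf_factors(2) [symmetric]
    by (simp add: power2_eq_square mult_ac)
qed

lemma phi_bar_eq_lerch_sum:
  "qpoch_inf (q ^ 2) (q ^ 2) * phi1_bar q = lerch_sum 3 (1 / q ^ 6) q (q ^ 8) - q ^ 6 * lerch_sum 3 (q ^ 6) (q ^ 5) (q ^ 8)"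
  "qpoch_inf (q ^ 2) (q ^ 2) * phi0_bar q = lerch_sum 3 (1 / q ^ 2) q (q ^ 8) - q ^ 8 * lerch_sum 3 (q ^ 10) (q ^ 5) (q ^ 8)"
proof -
  \<comment> \<open>The formula for the two functions together is used at \<open>s\<close> and at
    \<open>- s\<close>: only the sign of the \<open>phi0_bar\<close> part changes, so sum and
    difference separate them.\<close>
  define s where "s = csqrt q"
  have s2: "s ^ 2 = q" by (simp add: s_def)
  have s0: "s \<noteq> 0" using q0 by (simp add: s_def)
  have s1: "norm s < 1" using q1 s2 by (metis norm_power norm_ge_zero power_less_one_iff zero_less_numeral)
  have s4: "s ^ 4 = q ^ 2" "(s ^ 4) ^ 2 = q ^ 4" "(s ^ 4) ^ 3 = q ^ 6" "(s ^ 4) ^ 4 = q ^ 8"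
    unfolding s2 [symmetric] by simp_all
  define J where "J = qpoch_inf (q ^ 2) (q ^ 2)"
  have J: "J \<noteq> 0" unfolding J_def using norm_qpow by (intro qpoch_inf_nonzero power_mult_neq_1) auto
  have s4': "s ^ 4 \<noteq> 0" "norm (s ^ 4) < 1" using s0 s1 by (auto simp: norm_power power_less_one_iff)
  have os: "off_spiral s (s ^ 4)" "off_spiral (- s) (s ^ 4)"
    using off_spiral_power_mult[OF s0 s1, of 4 1] by auto
  define L where "L = (\<lambda>w x. lerch_sum 3 w x (s ^ 4))"
  have "phi1_bar q + s * phi0_bar q = L (- 1) s / J"
    using phi_bar_eq_rank_sum[OF s0 s1] rank_sum_eq_lerch_sum[OF s4' s0 os(1), of 1]
    by (simp add: s2 L_def J_def s4)
  then have e1: "J * (phi1_bar q + s * phi0_bar q) = L (- 1) s" using J by (simp add: field_simps)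
  have "phi1_bar q + (- s) * phi0_bar q = L (- 1) (- s) / J"
    using phi_bar_eq_rank_sum[of "- s"] rank_sum_eq_lerch_sum[OF s4' _ os(2), of 1] s0 s1
    by (simp add: s2 L_def J_def s4)
  then have e2: "J * (phi1_bar q - s * phi0_bar q) = L (- 1) (- s)" using J by (simp add: field_simps)
  have "2 * (J * phi1_bar q) = L (- 1) s + L (- 1) (- s)"
    unfolding e1 [symmetric] e2 [symmetric] by (simp add: algebra_simps)
  also have "\<dots> = 2 * (lerch_sum 3 (1 / q ^ 6) q (q ^ 8) - q ^ 6 * lerch_sum 3 (q ^ 6) (q ^ 5) (q ^ 8))"
    unfolding L_def by (subst lerch_sum_even_part[OF s4' s0 _ os]) (simp_all add: s2 s4 flip: power_Suc)
  finally show "qpoch_inf (q ^ 2) (q ^ 2) * phi1_bar q = lerch_sum 3 (1 / q ^ 6) q (q ^ 8) - q ^ 6 * lerch_sum 3 (q ^ 6) (q ^ 5) (q ^ 8)"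
    by (simp only: mult_cancel_left J_def) simp
  have q': "q ^ 4 / q ^ 6 = 1 / q ^ 2" using q0 by (simp add: eval_nat_numeral)
  have "s * (2 * (J * phi0_bar q)) = L (- 1) s - L (- 1) (- s)"
    unfolding e1 [symmetric] e2 [symmetric] by (simp add: algebra_simps)
  \<comment> \<open>The weight moves from -1 to -q^2, the base being s^4 = q^2, and the factor
    \<open>s\<close> cancels against the one in front of \<open>phi0_bar\<close>.\<close>
  also have "\<dots> = s * (L (- (q ^ 2)) s + L (- (q ^ 2)) (- s))"
    unfolding L_def by (subst lerch_sum_odd_part[OF s4' s0 _ os]) (simp_all add: s4)
  also have "L (- (q ^ 2)) s + L (- (q ^ 2)) (- s) =
      2 * (lerch_sum 3 (1 / q ^ 2) q (q ^ 8) - q ^ 8 * lerch_sum 3 (q ^ 10) (q ^ 5) (q ^ 8))"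
    unfolding L_def using q0
    by (subst lerch_sum_even_part[OF s4' s0 _ os]) (simp_all add: s2 s4 q' flip: power_Suc power_add)
  finally show "qpoch_inf (q ^ 2) (q ^ 2) * phi0_bar q = lerch_sum 3 (1 / q ^ 2) q (q ^ 8) - q ^ 8 * lerch_sum 3 (q ^ 10) (q ^ 5) (q ^ 8)"
    by (simp only: mult_cancel_left J_def) (use s0 in simp)
qed

end

theorem theorem1p8:
  fixes q :: complex
  assumes "q \<noteq> 0" and "norm q < 1"
  shows "q * phi0_bar q =
           - 1 + q * mock_g (- q) (q ^ 8) + theta_Jbar 2 4 q * theta_Jbar 3 8 q / theta_J1 2 q \<and>
         phi1_bar q =
           - (q ^ 2) * mock_g (- (q ^ 3)) (q ^ 8) + theta_Jbar 2 4 q * theta_Jbar 1 8 q / theta_J1 2 q"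
proof -
  note q = assms
  define L where "L = (\<lambda>w x. lerch_sum 3 w x (q ^ 8))"
  define T where "T z = theta_bracket z (q ^ 8)" for z
  define J where "J = qpoch_inf (q ^ 2) (q ^ 2)"
  define P where "P = qpoch_inf (q ^ 8) (q ^ 8)"
  have q8: "q ^ 8 \<noteq> 0" "norm (q ^ 8) < 1" using q norm_qpow[OF q, of 8] by auto
  have J: "J \<noteq> 0" unfolding J_def using norm_qpow[OF q] by (intro qpoch_inf_nonzero power_mult_neq_1) auto
  have P: "P \<noteq> 0" unfolding P_def using norm_qpow[OF q] by (intro qpoch_inf_nonzero power_mult_neq_1) auto
  have os: "off_spiral (q ^ i) (q ^ 8)" "off_spiral (- (q ^ i)) (q ^ 8)"
    "off_spiral (1 / q ^ i) (q ^ 8)" "off_spiral (- (1 / q ^ i)) (q ^ 8)" if "\<not> 8 dvd i" for i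
    using off_spiral_power_mult[OF q that] by auto
  have Tnz: "T (q ^ i) \<noteq> 0" "T (- (q ^ i)) \<noteq> 0" if "\<not> 8 dvd i" for i
    unfolding T_def using os[OF that] theta_bracket_nonzero[OF q8] by auto
  have nz: "T q \<noteq> 0" "T (- q) \<noteq> 0" "T (- (q ^ 2)) \<noteq> 0" "T (- (q ^ 3)) \<noteq> 0" "T (q ^ 4) \<noteq> 0" "T (q ^ 5) \<noteq> 0"
    using Tnz[of 1] Tnz[of 2] Tnz[of 3] Tnz[of 4] Tnz[of 5] by simp_all
  have Tinv: "T (1 / z) = - (T z / z)" if "z \<noteq> 0" for z
    unfolding T_def using theta_bracket_inverse[OF q8(2) that] .
  have T4: "T (1 / q ^ 4) = - (T (q ^ 4) / q ^ 4)"
    using Tinv[of "q ^ 4"] q by simp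
  have T2: "T (- (1 / q ^ 2)) = T (- (q ^ 2)) / q ^ 2"
    using Tinv[of "- (q ^ 2)"] q by simp
  have T1: "T (- (1 / q)) = T (- q) / q"
    using Tinv[of "- q"] q by simp
  have "q ^ 8 / - (q ^ 2) = - (q ^ 6)" using q by (simp add: eval_nat_numeral)
  then have T6': "T (- (q ^ 6)) = T (- (q ^ 2))"
    unfolding T_def using theta_bracket_reflect[OF q8(1), of "- (q ^ 2)"] q by simp
  have T6: "T (- (1 / q ^ 6)) = T (- (q ^ 2)) / q ^ 6"
    using Tinv[of "- (q ^ 6)"] q by (simp add: T6')
  have ratio: "T (q ^ 4) * P = J * T (- (q ^ 2))"
    unfolding T_def P_def J_def by (rule bracket_ratio[OF q])
  have product: "T (q ^ 4) * T (- (q ^ 2)) * P = theta_Jbar 2 4 q * (T q * T (q ^ 5) * (T (- q) * T (- (q ^ 3))))"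
    unfolding T_def P_def by (rule bracket_product[OF q])
  have phi1: "J * phi1_bar q = L (1 / q ^ 6) q - q ^ 6 * L (q ^ 6) (q ^ 5)"
    and phi0: "J * phi0_bar q = L (1 / q ^ 2) q - q ^ 8 * L (q ^ 10) (q ^ 5)"
    unfolding J_def L_def by (fact phi_bar_eq_lerch_sum[OF q])+
  have g3: "mock_g (- (q ^ 3)) (q ^ 8) = L (- 1) (- (q ^ 3)) / P"
    using q mock_g_eq_rank_sum_1[OF q8(2,1) os(2)[of 3]] rank_sum_eq_lerch_sum[OF q8 _ os(2)[of 3], of 1]
    by (simp add: L_def P_def)
  \<comment> \<open>Here the series with a = 0 is the right one, because its weight is -1/q^8. It
    represents 1 - q \<open>mock_g\<close> instead of \<open>mock_g\<close>, which is the origin of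
    the summand -1 in the first formula.\<close>
  have g1: "1 - q * mock_g (- q) (q ^ 8) = L (- (1 / q ^ 8)) (- q) / P"
  proof -
    have os1: "off_spiral (- q) (q ^ 8)" using os(2)[of 1] by simp
    have "rank_sum 0 (- q) (q ^ 8) = 1 - q * mock_g (- q) (q ^ 8)"
      using q rank_sum_0_1[OF q8(2,1) os1] mock_g_eq_rank_sum_1[OF q8(2,1) os1] by simp
    then show ?thesis
      using q rank_sum_eq_lerch_sum[OF q8 _ os1, of 0] by (simp add: L_def P_def power_int_minus divide_inverse)
  qed
  have eq1: "P ^ 2 / (T q * T (q ^ 5) * T (- (q ^ 3))) =
      L (1 / q ^ 6) q / (T (q ^ 4) * T (- (q ^ 2))) + L (q ^ 6) (q ^ 5) / (T (1 / q ^ 4) * T (- (1 / q ^ 2))) +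
      L (- 1) (- (q ^ 3)) / (T (- (1 / q ^ 2)) * T (- (q ^ 2)))"
  proof -
    have e: "q ^ 5 / q = q ^ 4" "- (q ^ 3) / q = - (q ^ 2)" "q / q ^ 5 = 1 / q ^ 4" "- (q ^ 3) / q ^ 5 = - (1 / q ^ 2)"
      "q / - (q ^ 3) = - (1 / q ^ 2)" "q ^ 5 / - (q ^ 3) = - (q ^ 2)"
      "- (q ^ 2 / (q ^ 5 * - (q ^ 3))) = 1 / q ^ 6" "- ((q ^ 5) ^ 2 / (q * - (q ^ 3))) = q ^ 6"
      "- ((- (q ^ 3)) ^ 2 / (q * q ^ 5)) = - 1"
      using q(1) by (simp_all add: field_simps flip: power_add power_mult power_Suc power_Suc2)
    have "off_spiral q (q ^ 8)" using os(1)[of 1] by simp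
    then show ?thesis
      using theta_partial_fractions_3[OF q8, of q "q ^ 5" "- (q ^ 3)"] q(1) os[of 2] os[of 3] os[of 4] os[of 5]
      unfolding e T_def L_def P_def by simp
  qed
  have eq0: "P ^ 2 / (T q * T (q ^ 5) * T (- (1 / q))) =
      L (1 / q ^ 2) q / (T (q ^ 4) * T (- (1 / q ^ 2))) + L (q ^ 10) (q ^ 5) / (T (1 / q ^ 4) * T (- (1 / q ^ 6))) +
      L (- (1 / q ^ 8)) (- (1 / q)) / (T (- (q ^ 2)) * T (- (q ^ 6)))"
  proof -
    have e: "q ^ 5 / q = q ^ 4" "- (1 / q) / q = - (1 / q ^ 2)" "q / q ^ 5 = 1 / q ^ 4" "- (1 / q) / q ^ 5 = - (1 / q ^ 6)"
      "q / - (1 / q) = - (q ^ 2)" "q ^ 5 / - (1 / q) = - (q ^ 6)"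
      "- (q ^ 2 / (q ^ 5 * - (1 / q))) = 1 / q ^ 2" "- ((q ^ 5) ^ 2 / (q * - (1 / q))) = q ^ 10"
      "- ((- (1 / q)) ^ 2 / (q * q ^ 5)) = - (1 / q ^ 8)"
      using q(1) by (simp_all add: field_simps flip: power_add power_mult power_Suc power_Suc2)
        (simp_all add: power2_eq_square)
    have "off_spiral q (q ^ 8)" "off_spiral (- (1 / q)) (q ^ 8)" using os(1)[of 1] os(4)[of 1] by simp_all
    then show ?thesis
      using theta_partial_fractions_3[OF q8, of q "q ^ 5" "- (1 / q)"] q(1) os[of 2] os[of 4] os[of 5] os[of 6]
      unfolding e T_def L_def P_def by simp
  qed
  \<comment> \<open>Inversion with base q^8 sends a weight w to 1/(w q^16), which fixes
    -1/q^8.\<close>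
  have L_inv: "L (- (1 / q ^ 8)) (- (1 / q)) = q * L (- (1 / q ^ 8)) (- q)"
  proof -
    have "inverse (- (1 / q ^ 8) * (q ^ 8) ^ 2) = - (1 / q ^ 8)"
      using q by (simp add: field_simps flip: power_mult power_add)
    then show ?thesis
      using lerch_sum_inverse[OF q8, of "- q" "- (1 / q ^ 8)"] os(2)[of 1] q by (simp add: L_def)
  qed
  have "J * (phi1_bar q + q ^ 2 * mock_g (- (q ^ 3)) (q ^ 8)) = theta_Jbar 2 4 q * theta_Jbar 1 8 q"
  proof -
    \<comment> \<open>The multiplier normalises the first coefficient to 1. By \<open>T4\<close> and
      \<open>T2\<close> the second becomes -q^6, exactly as in \<open>phi1\<close>.\<close>
    have "T (q ^ 4) * T (- (q ^ 2)) * (P ^ 2 / (T q * T (q ^ 5) * T (- (q ^ 3)))) =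
       J * phi1_bar q + q ^ 2 * (T (q ^ 4) / T (- (q ^ 2))) * L (- 1) (- (q ^ 3))"
      unfolding phi1 eq1 T4 T2 using nz q(1) by (simp add: field_simps flip: power_add)
    moreover have "T (q ^ 4) / T (- (q ^ 2)) = J / P" using ratio nz P by (simp add: field_simps)
    moreover have "T (q ^ 4) * T (- (q ^ 2)) * (P ^ 2 / (T q * T (q ^ 5) * T (- (q ^ 3)))) =
        theta_Jbar 2 4 q * (T (- q) * P)"
      using product nz by (simp add: field_simps power2_eq_square)
    ultimately show ?thesis
      by (simp add: theta_Jbar_1_8[OF q] T_def [symmetric] P_def [symmetric] g3 algebra_simps)
  qed
  moreover have "J * (q * phi0_bar q + (1 - q * mock_g (- q) (q ^ 8))) = theta_Jbar 2 4 q * theta_Jbar 3 8 q"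
  proof -
    \<comment> \<open>The first coefficient becomes q and the second -q^9, hence q times the
      combination in \<open>phi0\<close>; the extra division by q also absorbs the factor from
      \<open>T1\<close> on the left and from \<open>L_inv\<close> on the right.\<close>
    have "T (q ^ 4) * T (- (q ^ 2)) / q * (P ^ 2 / (T q * T (q ^ 5) * T (- (1 / q)))) =
       q * (J * phi0_bar q) + T (q ^ 4) / T (- (q ^ 2)) * L (- (1 / q ^ 8)) (- q)"
      unfolding phi0 eq0 T4 T2 T6 T6' L_inv using nz q(1)
      by (simp add: field_simps flip: power_add power_Suc power_Suc2) (simp add: eval_nat_numeral)
    moreover have "T (q ^ 4) / T (- (q ^ 2)) = J / P" using ratio nz P by (simp add: field_simps)
    moreover have "T (q ^ 4) * T (- (q ^ 2)) / q * (P ^ 2 / (T q * T (q ^ 5) * T (- (1 / q)))) =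
        theta_Jbar 2 4 q * (T (- (q ^ 3)) * P)"
      using product nz q(1) unfolding T1 by (simp add: field_simps power2_eq_square)
    ultimately show ?thesis
      unfolding g1 by (simp add: theta_Jbar_3_8[OF q] T_def [symmetric] P_def [symmetric] algebra_simps)
  qed
  ultimately show ?thesis
    using J unfolding theta_J1_2[OF q] J_def [symmetric] by (simp add: field_simps)
qed

end
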